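(* Suppose $f\in\mathbb{Z}[x]$ has an irreducible factor of degree $\ge 2$, i.e. $f(x)$ is not a product of linear polynomials (over $\mathbb{Q}$). Then $$N\log N\ \ll\ \log L_f(N)\ \ll\ N\log N ,$$ where $L_f(N):=\operatorname{lcm}\{f(n): n=1,\dots,N\}$.
   Context: For a polynomial $f\in\mathbb{Z}[x]$ with integer coefficients, $L_f(N)$ denotes the least common multiple of the values $f(1),\dots,f(N)$ of $f$ at the first $N$ positive integers. The statement concerns the growth of $\log L_f(N)$ as $N\to\infty$: the notation $A(N)\ll B(N)$ means that $A(N)\le C\,B(N)$ for all sufficiently large $N$, with a constant $C>0$ that may depend on $f$.
   Formalization: L_f(N) is taken as the lcm of the nonzero values among f(1),…,f(N), since for f with a positive integer root, such as (x−1)(x²+1), the literal lcm is 0 and its logarithm undefined; f is assumed nonzero. *)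

theory Defs
  imports Complex_Main "HOL-Computational_Algebra.Polynomial"
begin

text \<open>
  The least common multiple \<open>L\<^sub>f(N)\<close> of \<open>f(1), \<dots>, f(N)\<close>.  Since \<^const>\<open>Lcm\<close> of a set
  containing \<open>0\<close> is \<open>0\<close>, whose logarithm is meaningless, the finitely many
  vanishing values are left out; for a polynomial without positive integer roots nothing is
  removed (see \<open>lcm_values_eq_Lcm\<close> below).  \<^const>\<open>Lcm\<close> on the integers is nonnegative,
  so signs of the values do not matter.
\<close>

definition lcm_values :: "int poly \<Rightarrow> nat \<Rightarrow> int" where
  "lcm_values f N = Lcm ((\<lambda>n. poly f (int n)) ` {1..N} - {0})"

lemma lcm_values_eq_Lcm:
  assumes "\<And>n. n \<in> {1..N} \<Longrightarrow> poly f (int n) \<noteq> 0"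
  shows "lcm_values f N = (LCM n\<in>{1..N}. poly f (int n))"
proof -
  have "(\<lambda>n. poly f (int n)) ` {1..N} - {0} = (\<lambda>n. poly f (int n)) ` {1..N}"
    using assms by force
  then show ?thesis
    by (simp add: lcm_values_def)
qed

lemma lcm_values_pos: "lcm_values f N > 0"
proof -
  have "lcm_values f N \<noteq> 0"
    unfolding lcm_values_def by (subst Lcm_0_iff) auto
  moreover have "lcm_values f N \<ge> 0"
    unfolding lcm_values_def by simp
  ultimately show ?thesis by linarith
qed

end

theory Submission
  imports Defs "HOL-Analysis.Convex" "HOL-Analysis.Summation_Tests"
    "HOL-Computational_Algebra.Polynomial_Factorial" "HOL-Computational_Algebra.Field_as_Ring"
begin

text \<open>
  Let \<open>g\<close> be a primitive irreducible factor of \<open>f\<close> of degree \<open>d \<ge> 2\<close> and let \<open>\<rho>(p)\<close> be the number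
  of roots of \<open>g\<close> modulo \<open>p\<close>.  The product of the \<open>\<bar>g(n)\<bar>\<close>, \<open>n \<le> N\<close>, has logarithm
  \<open>d N log N + O(N)\<close>.  A prime \<open>p > N\<close> divides at most \<open>d\<close> of the factors, so all primes \<open>p > N\<close>
  together contribute at most \<open>d log L\<^sub>f(N) + O(1)\<close>.  The primes \<open>p \<le> N\<close> contribute
  \<open>N S(N) + O(N)\<close> with \<open>S(Y) = \<Sum>\<^bsub>p \<le> Y\<^esub> \<rho>(p) log p / p\<close>, so it suffices that
  \<open>S(Y) \<le> (d/2) log Y + O(1)\<close>; the prime ideal theorem is not needed.

  For this bound take \<open>Y = X\<^sup>2\<close> and the homogenization \<open>F\<close> of \<open>g\<close>, which vanishes only at the
  origin.  Sum \<open>log \<bar>F(u - v)\<bar> \<le> d log X + O(1)\<close> over all pairs \<open>u \<noteq> v\<close> of points of \<open>[0, X)\<^sup>2\<close>.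
  A root \<open>r\<close> modulo \<open>p\<close> defines a lattice \<open>a \<equiv> r b (mod p)\<close> on which \<open>p\<close> divides \<open>F(a, b)\<close>, and by
  Cauchy-Schwarz at least \<open>X\<^sup>4 / p - X\<^sup>2\<close> of the pairs have their difference in it.  This count is
  sharp up to \<open>p = X\<^sup>2\<close>, which is where the factor \<open>1/2\<close> comes from.
\<close>

subsection \<open>Chebyshev-type bounds\<close>

lemma prod_primes_dvd:
  fixes x :: nat and P :: "nat set"
  assumes "finite P" "\<And>p. p \<in> P \<Longrightarrow> prime p" "\<And>p. p \<in> P \<Longrightarrow> p ^ m p dvd x"
  shows "(\<Prod>p\<in>P. p ^ m p) dvd x"
  using assms
proof (induction P rule: finite_induct)
  case (insert p P)
  have "coprime (p ^ m p) (\<Prod>q\<in>P. q ^ m q)"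
  proof (rule prod_coprime_right)
    fix q assume "q \<in> P"
    then have "coprime p q"
      using insert by (intro primes_coprime) auto
    then show "coprime (p ^ m p) (q ^ m q)" by simp
  qed
  then show ?case
    using insert by (simp add: divides_mult)
qed simp

text \<open>The powers \<open>p ^ m p\<close> are pairwise coprime, so their product divides
  \<open>x\<close>. The exponents are free: below, \<open>m\<close> is sometimes a true multiplicity
  and sometimes a number of roots.\<close>

lemma sum_ln_primes_le:
  fixes x :: nat and P :: "nat set"
  assumes "finite P" "\<And>p. p \<in> P \<Longrightarrow> prime p" "\<And>p. p \<in> P \<Longrightarrow> p ^ m p dvd x" "x > 0"
  shows "(\<Sum>p\<in>P. real (m p) * ln p) \<le> ln x"
proof -
  have pos: "p > 0" if "p \<in> P" for p
    using assms(2)[OF that] prime_gt_0_nat by blast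
  have "(\<Prod>p\<in>P. p ^ m p) \<le> x"
    using prod_primes_dvd[OF assms(1-3)] assms(4) by (intro dvd_imp_le) auto
  then have "real (\<Prod>p\<in>P. p ^ m p) \<le> real x"
    by (subst of_nat_le_iff)
  then have "(\<Prod>p\<in>P. real p ^ m p) \<le> real x"
    by simp
  then have "ln (\<Prod>p\<in>P. real p ^ m p) \<le> ln x"
    using assms(4) pos by (subst ln_le_cancel_iff) (auto intro!: prod_pos)
  also have "ln (\<Prod>p\<in>P. real p ^ m p) = (\<Sum>p\<in>P. ln (real p ^ m p))"
    using pos by (intro ln_prod) (auto simp: assms(1))
  also have "\<dots> = (\<Sum>p\<in>P. real (m p) * ln p)"
    using pos by (intro sum.cong) (auto simp: ln_realpow)
  finally show ?thesis .
qed

lemma ln_eq_sum_multiplicity: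
  fixes x :: nat
  assumes "x > 0"
  shows "ln x = (\<Sum>p\<in>prime_factors x. real (multiplicity p x) * ln p)"
proof -
  have "x = (\<Prod>p\<in>prime_factors x. p ^ multiplicity p x)"
    using prod_prime_factors[of x] assms by simp
  then have "real x = real (\<Prod>p\<in>prime_factors x. p ^ multiplicity p x)"
    by (rule arg_cong)
  also have "\<dots> = (\<Prod>p\<in>prime_factors x. real p ^ multiplicity p x)"
    by simp
  also have "ln \<dots> = (\<Sum>p\<in>prime_factors x. ln (real p ^ multiplicity p x))"
    by (intro ln_prod) (auto simp: in_prime_factors_iff prime_gt_0_nat)
  also have "\<dots> = (\<Sum>p\<in>prime_factors x. real (multiplicity p x) * ln p)"
    by (intro sum.cong) (auto simp: ln_realpow in_prime_factors_iff prime_gt_0_nat)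
  finally show ?thesis .
qed

definition primes_upto :: "nat \<Rightarrow> nat set" where
  "primes_upto n = {p. prime p \<and> p \<le> n}"

lemma finite_primes_upto [simp]: "finite (primes_upto n)"
  unfolding primes_upto_def by (rule finite_subset[of _ "{..n}"]) auto

text \<open>The two middle coefficients are equal and are among the summands of
  \<open>2 ^ (2 * m + 1)\<close>.\<close>

lemma binomial_odd_middle_le: "(2 * m + 1) choose m \<le> 4 ^ m"
proof -
  have "2 * ((2 * m + 1) choose m) = ((2*m+1) choose m) + ((2*m+1) choose (m + 1))"
    using binomial_symmetric[of m "2*m+1"] by simp
  also have "\<dots> = (\<Sum>k\<in>{m, m+1}. (2*m+1) choose k)" by simp
  also have "\<dots> \<le> (\<Sum>k\<le>2*m+1. (2*m+1) choose k)"
    by (intro sum_mono2) auto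
  also have "\<dots> = 2 * 4 ^ m"
    by (subst choose_row_sum) (simp add: power_mult)
  finally show ?thesis by simp
qed

text \<open>Erdos's argument. Even \<open>n > 2\<close> reduces to \<open>n - 1\<close>. For
  \<open>n = 2 * m + 1\<close> the primes above \<open>m + 1\<close> divide
  \<open>(2 * m + 1)!\<close> but neither \<open>m!\<close> nor \<open>(m + 1)!\<close>, hence
  divide the middle binomial coefficient, and the induction hypothesis covers the primes up to
  \<open>m + 1\<close>.\<close>

lemma prod_primes_upto_le: "\<Prod>(primes_upto n) \<le> 4 ^ n"
proof (induction n rule: less_induct)
  case (less n)
  consider "n \<le> 1" | "n = 2" | "n > 2" "even n" | m where "n > 2" "n = 2 * m + 1"
    by (metis One_nat_def Suc_1 Suc_eq_plus1 Suc_leI evenE le_neq_implies_less not_less oddE)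
  then show ?case
  proof cases
    case 1
    then have "primes_upto n = {}"
      by (auto simp: primes_upto_def dest: prime_ge_2_nat)
    then show ?thesis by simp
  next
    case 2
    then have "primes_upto n = {2}"
      by (auto simp: primes_upto_def dest: prime_ge_2_nat)
    then show ?thesis using 2 by simp
  next
    case 3
    then have "\<not> prime n"
      using prime_odd_nat by blast
    then have "primes_upto n = primes_upto (n - 1)"
      using 3 by (auto simp: primes_upto_def) (metis Suc_pred le_Suc_eq less_nat_zero_code neq0_conv)
    then have "\<Prod>(primes_upto n) \<le> 4 ^ (n - 1)"
      using less[of "n - 1"] 3 by simp
    also have "\<dots> \<le> 4 ^ n" by (intro power_increasing) auto
    finally show ?thesis .
  next
    case 4
    define Q where "Q = {p. prime p \<and> m + 1 < p \<and> p \<le> n}"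
    have fin: "finite Q"
      unfolding Q_def by (rule finite_subset[of _ "{..n}"]) auto
    have eq: "primes_upto n = primes_upto (m + 1) \<union> Q"
      using 4 by (auto simp: primes_upto_def Q_def)
    have "(\<Prod>p\<in>Q. p ^ 1) dvd (2 * m + 1 choose m)"
    proof (rule prod_primes_dvd[OF fin])
      fix p assume p: "p \<in> Q"
      then have pr: "prime p" by (simp add: Q_def)
      then show "prime p" .
      have "fact m * fact (m + 1) * (2 * m + 1 choose m) = (fact (2 * m + 1) :: nat)"
        using binomial_fact_lemma[of m "2*m+1"] by (simp add: algebra_simps)
      moreover have "p dvd fact (2 * m + 1)"
        using p 4 pr by (subst prime_dvd_fact_iff) (auto simp: Q_def)
      moreover have "\<not> p dvd fact m" "\<not> p dvd fact (m + 1)"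
        using p pr by (auto simp: prime_dvd_fact_iff Q_def simp del: fact_Suc)
      ultimately have "p dvd (2 * m + 1 choose m)"
        using pr by (metis prime_dvd_mult_iff)
      then show "p ^ 1 dvd (2 * m + 1 choose m)" by simp
    qed
    then have "\<Prod>Q \<le> (2 * m + 1 choose m)"
      by (intro dvd_imp_le) (auto intro!: zero_less_binomial)
    also have "\<dots> \<le> 4 ^ m" by (rule binomial_odd_middle_le)
    finally have "\<Prod>Q \<le> 4 ^ m" .
    moreover have "\<Prod>(primes_upto (m + 1)) \<le> 4 ^ (m + 1)"
      using 4 by (intro less) auto
    moreover have "\<Prod>(primes_upto n) = \<Prod>(primes_upto (m + 1)) * \<Prod>Q"
      unfolding eq by (rule prod.union_disjoint) (auto simp: fin primes_upto_def Q_def)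
    ultimately have "\<Prod>(primes_upto n) \<le> 4 ^ (m + 1) * 4 ^ m"
      by (simp add: mult_le_mono)
    also have "\<dots> = 4 ^ n" using 4 by (simp add: power_add [symmetric])
    finally show ?thesis .
  qed
qed

lemma sum_ln_primes_upto_le: "(\<Sum>p\<in>primes_upto n. ln (real p)) \<le> real n * ln 4"
proof -
  have pos: "0 < p" if "p \<in> primes_upto n" for p
    using that by (auto simp: primes_upto_def prime_gt_0_nat)
  have "(\<Sum>p\<in>primes_upto n. ln (real p)) = ln (\<Prod>p\<in>primes_upto n. real p)"
    using pos by (intro ln_prod [symmetric]) auto
  also have "(\<Prod>p\<in>primes_upto n. real p) = real (\<Prod>(primes_upto n))"
    by simp
  also have "ln \<dots> \<le> ln (real (4 ^ n))"
    using prod_primes_upto_le[of n] pos by (subst ln_le_cancel_iff)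
      (auto simp flip: of_nat_prod simp del: of_nat_power of_nat_numeral intro!: prod_pos)
  also have "\<dots> = real n * ln 4" by (simp add: ln_realpow)
  finally show ?thesis .
qed

lemma ln_le_two_sqrt:
  assumes "x > (0::real)"
  shows "ln x \<le> 2 * sqrt x"
proof -
  have "ln x = 2 * ln (sqrt x)" using assms by (simp add: ln_sqrt)
  also have "ln (sqrt x) \<le> sqrt x" using ln_le_minus_one[of "sqrt x"] assms by simp
  finally show ?thesis by simp
qed

text \<open>At most \<open>sqrt n\<close> primes satisfy \<open>p ^ 2 \<le> n\<close>; for all
  others \<open>ln n \<le> 2 * ln p\<close>, so the bound on the sum of \<open>ln p\<close> applies.
  This makes an error of size \<open>ln N\<close> per prime add up to O(N).\<close>

lemma card_primes_upto_le:
  assumes "n \<ge> 1"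
  shows "real (card (primes_upto n)) * ln n \<le> (2 + 2 * ln 4) * n"
proof -
  define A where "A = {p \<in> primes_upto n. p ^ 2 \<le> n}"
  have A: "finite A" "A \<subseteq> primes_upto n" by (auto simp: A_def)
  have "card A \<le> card {1..nat \<lfloor>sqrt n\<rfloor>}"
  proof (rule card_mono)
    show "A \<subseteq> {1..nat \<lfloor>sqrt n\<rfloor>}"
    proof
      fix p assume p: "p \<in> A"
      then have "p \<ge> 1" using prime_ge_1_nat[of p] by (auto simp: A_def primes_upto_def)
      moreover have "real p \<le> sqrt n"
        using p by (intro real_le_rsqrt) (auto simp: A_def simp flip: of_nat_power)
      ultimately show "p \<in> {1..nat \<lfloor>sqrt n\<rfloor>}"
        by (auto simp: le_nat_iff le_floor_iff)
    qed
  qed simp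
  also have "\<dots> = nat \<lfloor>sqrt n\<rfloor>" by simp
  finally have cardA: "real (card A) \<le> sqrt n"
    by (smt (verit) le_nat_floor nat_le_real_less of_nat_floor of_nat_mono real_sqrt_ge_zero of_nat_0_le_iff)
  have "real (card (primes_upto n)) * ln n = (\<Sum>p\<in>primes_upto n. ln n)" by simp
  also have "\<dots> \<le> (\<Sum>p\<in>primes_upto n. (if p \<in> A then ln n else 0) + 2 * ln p)"
  proof (rule sum_mono)
    fix p assume p: "p \<in> primes_upto n"
    then have p1: "p \<ge> 1" using prime_ge_1_nat[of p] by (auto simp: primes_upto_def)
    show "ln n \<le> (if p \<in> A then ln n else 0) + 2 * ln p"
    proof (cases "p \<in> A")
      case True
      then show ?thesis using p1 by simp
    next
      case False
      then have "n \<le> p ^ 2" using p by (auto simp: A_def)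
      then have "real n \<le> real p ^ 2" by (metis of_nat_le_iff of_nat_power)
      then have "ln n \<le> ln (real p ^ 2)" using assms p1 by (subst ln_le_cancel_iff) auto
      then show ?thesis using False p1 by (simp add: ln_realpow)
    qed
  qed
  also have "\<dots> = real (card A) * ln n + 2 * (\<Sum>p\<in>primes_upto n. ln p)"
    using A by (simp add: sum.distrib sum_distrib_left sum.If_cases Int_absorb1)
  also have "\<dots> \<le> sqrt n * (2 * sqrt n) + 2 * (n * ln 4)"
    using assms
    by (intro add_mono mult_mono cardA ln_le_two_sqrt sum_ln_primes_upto_le mult_left_mono) auto
  also have "\<dots> = (2 + 2 * ln 4) * n"
    by (simp add: algebra_simps)
  finally show ?thesis .
qed

text \<open>Controls the higher prime powers. Since \<open>ln p \<le> 2 * sqrt p\<close>, the series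
  over all natural numbers with exponent -3/2 is a majorant.\<close>

lemma sum_ln_over_square_bounded:
  "\<exists>K\<ge>0. \<forall>n. (\<Sum>p\<in>primes_upto n. ln p / p ^ 2) \<le> (K::real)"
proof -
  define f :: "nat \<Rightarrow> real" where "f = (\<lambda>n. 2 * (real n powr (-3/2)))"
  have sf: "summable f"
    unfolding f_def by (intro summable_mult) (simp add: summable_real_powr_iff)
  have f0: "f n \<ge> 0" for n by (simp add: f_def)
  have "(\<Sum>p\<in>primes_upto n. ln p / p ^ 2) \<le> suminf f" for n
  proof -
    have "(\<Sum>p\<in>primes_upto n. ln p / p ^ 2) \<le> (\<Sum>p\<in>primes_upto n. f p)"
    proof (rule sum_mono)
      fix p assume "p \<in> primes_upto n"
      then have p: "p > 0" by (auto simp: primes_upto_def prime_gt_0_nat)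
      have "ln p / p ^ 2 \<le> 2 * sqrt p / p ^ 2"
        using p by (intro divide_right_mono ln_le_two_sqrt) auto
      moreover have "sqrt p / p ^ 2 = p powr (1/2 - 2)"
        using p by (subst powr_diff) (simp add: powr_half_sqrt)
      then have "2 * sqrt p / p ^ 2 = f p"
        by (simp add: f_def)
      ultimately show "ln p / p ^ 2 \<le> f p" by simp
    qed
    also have "\<dots> \<le> suminf f"
      by (intro sum_le_suminf sf) (auto simp: f0)
    finally show ?thesis .
  qed
  moreover have "suminf f \<ge> 0" by (intro suminf_nonneg sf f0)
  ultimately show ?thesis by blast
qed

subsection \<open>Roots modulo primes and the binary form\<close>

text \<open>Lagrange's bound on roots modulo a prime, phrased over the integers. Synthetic division
  splits off one root \<open>a\<close>; the other points stay roots of the quotient modulo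
  \<open>p\<close> because \<open>p\<close> does not divide \<open>s - a\<close>.\<close>

lemma many_roots_mod_imp_dvd:
  fixes p :: int and g :: "int poly"
  assumes "prime p" "finite S" "\<And>s. s \<in> S \<Longrightarrow> p dvd poly g s"
    and "\<And>s t. s \<in> S \<Longrightarrow> t \<in> S \<Longrightarrow> p dvd s - t \<Longrightarrow> s = t"
    and "degree g < card S"
  shows "[:p:] dvd g"
  using assms(2-)
proof (induction "degree g" arbitrary: g S)
  case 0
  obtain c where c: "g = [:c:]"
    using 0 by (metis degree_eq_zeroE)
  moreover obtain s where "s \<in> S"
    using 0 by fastforce
  then have "p dvd c" using 0(3)[of s] c by simp
  ultimately show ?case by simp
next
  case (Suc n)
  obtain a where a: "a \<in> S" using Suc.prems by fastforce
  define h where "h = synthetic_div g a"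
  have g: "g = [:-a, 1:] * h + [:poly g a:]"
    unfolding h_def by (rule synthetic_div_correct' [symmetric])
  have "[:p:] dvd h"
  proof (rule Suc.hyps(1)[of h "S - {a}"])
    show "n = degree h" using Suc.hyps(2) by (simp add: h_def degree_synthetic_div)
    show "degree h < card (S - {a})"
      using Suc.prems a Suc.hyps(2) by (simp add: h_def degree_synthetic_div)
    show "p dvd poly h s" if s: "s \<in> S - {a}" for s
    proof -
      have "poly g s = (s - a) * poly h s + poly g a"
        by (subst g) (simp add: algebra_simps)
      moreover have "p dvd poly g s" "p dvd poly g a"
        using Suc.prems s a by auto
      ultimately have "p dvd (s - a) * poly h s"
        by (metis dvd_add_left_iff)
      moreover have "\<not> p dvd s - a" using Suc.prems(3)[of s a] s a by auto
      ultimately show ?thesis using assms(1) by (simp add: prime_dvd_mult_iff)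
    qed
  qed (use Suc.prems in auto)
  moreover have "[:p:] dvd [:poly g a:]" using Suc.prems(2)[OF a] by simp
  ultimately show ?case by (subst g) (intro dvd_add dvd_mult)
qed

definition roots_mod :: "int poly \<Rightarrow> nat \<Rightarrow> nat set" where
  "roots_mod g p = {r. r < p \<and> int p dvd poly g (int r)}"

lemma finite_roots_mod [simp]: "finite (roots_mod g p)"
  by (simp add: roots_mod_def)

lemma int_eq_if_dvd_diff:
  assumes "int p dvd int r - int s" "r < p" "s < p"
  shows "r = s"
  using assms zdvd_not_zless[of "int r - int s" "int p"] zdvd_not_zless[of "int s - int r" "int p"]
  by (cases r s rule: linorder_cases) (auto simp: dvd_diff_commute)

lemma prime_not_dvd_primitive:
  fixes g :: "int poly"
  assumes "content g = 1" "prime p"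
  shows "\<not> [:int p:] dvd g"
proof
  assume "[:int p:] dvd g"
  then have "int p dvd 1" using assms(1) by (simp add: const_poly_dvd_iff_dvd_content)
  then show False using assms(2) by simp
qed

text \<open>Content 1 excludes that \<open>p\<close> divides \<open>g\<close>. Any incongruent
  representatives are allowed, since the bound serves both for residues below \<open>p\<close> and
  for arguments \<open>n \<le> N < p\<close>.\<close>

lemma card_incongruent_roots_le:
  fixes g :: "int poly"
  assumes "content g = 1" "prime p" "finite S" "\<And>s. s \<in> S \<Longrightarrow> int p dvd poly g (int s)"
    and "\<And>s t. s \<in> S \<Longrightarrow> t \<in> S \<Longrightarrow> int p dvd int s - int t \<Longrightarrow> s = t"
  shows "card S \<le> degree g"
proof (rule ccontr)
  assume "\<not> card S \<le> degree g"
  moreover have "card (int ` S) = card S" by (intro card_image) simp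
  ultimately have "[:int p:] dvd g"
    using assms by (intro many_roots_mod_imp_dvd[where S = "int ` S"]) auto
  then show False using prime_not_dvd_primitive assms by blast
qed

lemma card_roots_mod_le:
  assumes "content g = 1" "prime p"
  shows "card (roots_mod g p) \<le> degree g"
  using assms
  by (intro card_incongruent_roots_le) (auto simp: roots_mod_def intro: int_eq_if_dvd_diff)

definition homogenize :: "int poly \<Rightarrow> int \<Rightarrow> int \<Rightarrow> int" where
  "homogenize g a b = (\<Sum>i\<le>degree g. coeff g i * a ^ i * b ^ (degree g - i))"

lemma homogenize_mult_left: "homogenize g (r * b) b = b ^ degree g * poly g r"
proof -
  have "homogenize g (r * b) b = (\<Sum>i\<le>degree g. b ^ degree g * (coeff g i * r ^ i))"
    unfolding homogenize_def
  proof (rule sum.cong)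
    fix i assume "i \<in> {..degree g}"
    then have "b ^ degree g = b ^ i * b ^ (degree g - i)"
      by (simp flip: power_add)
    then show "coeff g i * (r * b) ^ i * b ^ (degree g - i) = b ^ degree g * (coeff g i * r ^ i)"
      by (simp add: power_mult_distrib)
  qed simp
  then show ?thesis by (simp add: poly_altdef sum_distrib_left)
qed

text \<open>Modulo \<open>p\<close> the value agrees with the one at \<open>(r * b, b)\<close>,
  which is \<open>b ^ degree g * poly g r\<close>.\<close>

lemma dvd_homogenize:
  assumes "p dvd a - r * b" "p dvd poly g r"
  shows "p dvd homogenize g a b"
proof -
  have "p dvd homogenize g a b - homogenize g (r * b) b"
    unfolding homogenize_def sum_subtractf [symmetric]
  proof (rule dvd_sum)
    fix i
    have "p dvd a ^ i - (r * b) ^ i"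
      using assms(1) by (simp add: power_diff_sumr2)
    then have "p dvd (a ^ i - (r * b) ^ i) * (coeff g i * b ^ (degree g - i))"
      by (rule dvd_mult2)
    then show "p dvd coeff g i * a ^ i * b ^ (degree g - i) -
        coeff g i * (r * b) ^ i * b ^ (degree g - i)"
      by (simp add: algebra_simps)
  qed
  moreover have "p dvd homogenize g (r * b) b"
    using assms(2) by (simp add: homogenize_mult_left)
  ultimately show ?thesis by (metis diff_add_cancel dvd_add)
qed

text \<open>Every monomial of the form has total degree \<open>degree g\<close>. This handles pairs
  that lie in the lattices of several roots at once.\<close>

lemma power_dvd_homogenize:
  assumes "p dvd a" "p dvd b"
  shows "p ^ degree g dvd homogenize g a b"
  unfolding homogenize_def
proof (rule dvd_sum)
  fix i assume "i \<in> {..degree g}"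
  then have "p ^ degree g = p ^ i * p ^ (degree g - i)" by (simp flip: power_add)
  moreover have "p ^ i * p ^ (degree g - i) dvd a ^ i * b ^ (degree g - i)"
    using assms by (intro mult_dvd_mono dvd_power_same)
  ultimately show "p ^ degree g dvd coeff g i * a ^ i * b ^ (degree g - i)"
    by (simp add: mult.assoc)
qed

lemma abs_homogenize_le:
  assumes "\<bar>a\<bar> \<le> X" "\<bar>b\<bar> \<le> X"
  shows "\<bar>homogenize g a b\<bar> \<le> (\<Sum>i\<le>degree g. \<bar>coeff g i\<bar>) * X ^ degree g"
proof -
  have "\<bar>homogenize g a b\<bar> \<le> (\<Sum>i\<le>degree g. \<bar>coeff g i * a ^ i * b ^ (degree g - i)\<bar>)"
    unfolding homogenize_def by (rule sum_abs)
  also have "\<dots> \<le> (\<Sum>i\<le>degree g. \<bar>coeff g i\<bar> * X ^ degree g)"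
  proof (rule sum_mono)
    fix i assume "i \<in> {..degree g}"
    then have "X ^ degree g = X ^ i * X ^ (degree g - i)" by (simp flip: power_add)
    moreover have "\<bar>a\<bar> ^ i * \<bar>b\<bar> ^ (degree g - i) \<le> X ^ i * X ^ (degree g - i)"
      using assms by (intro mult_mono power_mono) auto
    ultimately show "\<bar>coeff g i * a ^ i * b ^ (degree g - i)\<bar> \<le> \<bar>coeff g i\<bar> * X ^ degree g"
      by (simp add: abs_mult power_abs mult.assoc mult_left_mono)
  qed
  finally show ?thesis by (simp add: sum_distrib_right)
qed

lemma sum_abs_coeff_ge_1:
  fixes f :: "int poly"
  assumes "f \<noteq> 0"
  shows "(\<Sum>i\<le>degree f. \<bar>coeff f i\<bar>) \<ge> 1"
proof -
  have "(\<Sum>i\<le>degree f. \<bar>coeff f i\<bar>) \<noteq> 0"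
    using assms by (subst sum_nonneg_eq_0_iff) (auto intro!: bexI[of _ "degree f"])
  moreover have "(\<Sum>i\<le>degree f. \<bar>coeff f i\<bar>) \<ge> 0" by (intro sum_nonneg) auto
  ultimately show ?thesis by linarith
qed

section \<open>Double counting of differences that lie in the root lattices\<close>

lemma card_collisions_ge:
  assumes "finite B" "card (f ` B) \<le> p"
  shows "real (card B) ^ 2 \<le> p * real (card {(u, v) \<in> B \<times> B. f u = f v})"
proof -
  define F where "F = (\<lambda>c. {u \<in> B. f u = c})"
  have "{(u, v) \<in> B \<times> B. f u = f v} = (\<Union>c\<in>f ` B. F c \<times> F c)"
    by (auto simp: F_def)
  also have "card \<dots> = (\<Sum>c\<in>f ` B. card (F c \<times> F c))"
    using assms(1) by (intro card_UN_disjoint) (auto simp: F_def)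
  finally have pairs: "real (card {(u, v) \<in> B \<times> B. f u = f v}) = (\<Sum>c\<in>f ` B. (real (card (F c))) ^ 2)"
    by (simp add: card_cartesian_product power2_eq_square)
  have "B = (\<Union>c\<in>f ` B. F c)" by (auto simp: F_def)
  then have "card B = card (\<Union>c\<in>f ` B. F c)" by simp
  also have "\<dots> = (\<Sum>c\<in>f ` B. card (F c))"
    using assms(1) by (intro card_UN_disjoint) (auto simp: F_def)
  finally have "real (card B) ^ 2 = (\<Sum>c\<in>f ` B. real (card (F c))) ^ 2" by simp
  \<comment> \<open>Cauchy-Schwarz for the fibre sizes: they add up to \<open>card B\<close>, and
    their squares add up to the number of colliding pairs.\<close>
  also have "\<dots> \<le> (\<Sum>c\<in>f ` B. (real (card (F c))) ^ 2) * real (card (f ` B))"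
    by (rule sum_squared_le_sum_of_squares)
  also have "\<dots> \<le> (\<Sum>c\<in>f ` B. (real (card (F c))) ^ 2) * p"
    using assms(2) by (intro mult_left_mono sum_nonneg) auto
  finally show ?thesis using pairs by (simp add: mult.commute)
qed

lemma sum_card_filter_swap:
  assumes "finite A" "finite B"
  shows "(\<Sum>a\<in>A. card {b \<in> B. Q a b}) = (\<Sum>b\<in>B. card {a \<in> A. Q a b})"
proof -
  have "(\<Sum>a\<in>A. card {b \<in> B. Q a b}) = (\<Sum>a\<in>A. \<Sum>b\<in>B. if Q a b then 1 else 0)"
    unfolding card_eq_sum by (intro sum.cong refl sum.inter_filter assms)
  also have "\<dots> = (\<Sum>b\<in>B. \<Sum>a\<in>A. if Q a b then 1 else 0)"
    by (rule sum.swap)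
  also have "\<dots> = (\<Sum>b\<in>B. card {a \<in> A. Q a b})"
    unfolding card_eq_sum by (intro sum.cong refl sum.inter_filter [symmetric] assms)
  finally show ?thesis .
qed

text \<open>The weight \<open>ln p\<close> is summed over all triples of a prime, a root and a pair
  \<open>w\<close> of distinct points whose difference lies in the lattice of that root. For a fixed
  pair the total is at most \<open>M\<close>, because a product of prime powers divides a nonzero
  value of the form; for a fixed prime and root there are at least \<open>X^4 / p - X^2\<close>
  pairs. Comparing and dividing by \<open>X^4\<close> gives the coefficient \<open>degree g\<close>
  of \<open>ln X\<close> although the primes run up to \<open>X^2\<close>.\<close>

lemma sum_roots_mod_le:
  fixes g :: "int poly"
  assumes prim: "content g = 1"
    and nz: "\<And>a b. homogenize g a b = 0 \<Longrightarrow> a = 0 \<and> b = 0"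
    and X: "X \<ge> 1"
  shows "(\<Sum>p\<in>primes_upto (X ^ 2). real (card (roots_mod g p)) * (ln p / p)) \<le>
           degree g * ln X + (ln (real_of_int (\<Sum>i\<le>degree g. \<bar>coeff g i\<bar>)) + degree g * ln 4)"
proof -
  define d where "d = degree g"
  define C where "C = (\<Sum>i\<le>degree g. \<bar>coeff g i\<bar>)"
  define B where "B = {0..<X} \<times> {0..<X}"
  define U where "U = {(u, v) \<in> B \<times> B. u \<noteq> v}"
  \<comment> \<open>The two coordinates of the difference \<open>u - v\<close> for
    \<open>w = (u, v)\<close>; \<open>m p w\<close> below counts the roots whose lattice contains
    this difference.\<close>
  define \<alpha> \<beta> where "\<alpha> = (\<lambda>w::(nat \<times> nat) \<times> nat \<times> nat. int (fst (fst w)) - int (fst (snd w)))"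
    and "\<beta> = (\<lambda>w::(nat \<times> nat) \<times> nat \<times> nat. int (snd (fst w)) - int (snd (snd w)))"
  define m where "m = (\<lambda>p w. card {r \<in> roots_mod g p. int p dvd \<alpha> w - int r * \<beta> w})"
  define P where "P = primes_upto (X ^ 2)"
  \<comment> \<open>The coordinates of a difference are at most \<open>X\<close> in absolute value,
    so \<open>M\<close> bounds the logarithm of every value of the form that occurs.\<close>
  define M where "M = ln C + d * ln X"
  have fin: "finite B" "finite U" "finite P"
    unfolding U_def B_def P_def by (auto intro: finite_subset[of _ "B \<times> B"] simp: B_def)
  have P: "prime p" if "p \<in> P" for p using that by (simp add: P_def primes_upto_def)
  have "g \<noteq> 0" using prim by auto
  then have C: "C \<ge> 1" unfolding C_def by (rule sum_abs_coeff_ge_1)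
  have M0: "M \<ge> 0" unfolding M_def using C X by simp
  have upper: "(\<Sum>p\<in>P. real (m p w) * ln p) \<le> M" if w: "w \<in> U" for w
  proof -
    define F where "F = homogenize g (\<alpha> w) (\<beta> w)"
    have "\<not> (\<alpha> w = 0 \<and> \<beta> w = 0)"
      using w by (auto simp: U_def \<alpha>_def \<beta>_def)
    then have "F \<noteq> 0" by (metis nz F_def)
    have "(\<Sum>p\<in>P. real (m p w) * ln p) \<le> ln (nat \<bar>F\<bar>)"
    proof (rule sum_ln_primes_le)
      fix p assume p: "p \<in> P"
      define R where "R = {r \<in> roots_mod g p. int p dvd \<alpha> w - int r * \<beta> w}"
      have finR: "finite R" by (simp add: R_def)
      \<comment> \<open>The sets of pairs for different roots overlap only where \<open>p\<close> divides both coordinates;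
        there \<open>p ^ d\<close> divides \<open>F\<close>, so the overlap does no harm.\<close>
      have "int p ^ card R dvd F"
      proof (cases "int p dvd \<beta> w")
        case True
        show ?thesis
        proof (cases "R = {}")
          case False
          then obtain r where "int p dvd \<alpha> w - int r * \<beta> w" by (auto simp: R_def)
          then have "int p dvd \<alpha> w"
            using True by (metis dvd_add_left_iff diff_add_cancel dvd_mult dvd_add)
          then have "int p ^ d dvd F"
            using True unfolding F_def d_def by (intro power_dvd_homogenize)
          moreover have "card R \<le> card (roots_mod g p)"
            unfolding R_def by (intro card_mono) auto
          then have "card R \<le> d"
            using card_roots_mod_le[OF prim P[OF p]] by (simp add: d_def)
          ultimately show ?thesis by (meson dvd_trans le_imp_power_dvd)
        qed auto
      next
        case False
        have "r = s" if "r \<in> R" "s \<in> R" for r s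
        proof -
          have "int p dvd (\<alpha> w - int s * \<beta> w) - (\<alpha> w - int r * \<beta> w)"
            by (rule dvd_diff) (use that in \<open>auto simp: R_def\<close>)
          then have "int p dvd (int r - int s) * \<beta> w" by (simp add: algebra_simps)
          then have "int p dvd int r - int s"
            using False P[OF p] by (simp add: prime_dvd_mult_iff)
          then show ?thesis
            by (rule int_eq_if_dvd_diff) (use that in \<open>auto simp: R_def roots_mod_def\<close>)
        qed
        then consider "R = {}" | r where "R = {r}" by blast
        then show ?thesis
        proof cases
          case 2
          then have "int p dvd F"
            unfolding F_def R_def by (intro dvd_homogenize[of _ _ "int r"]) (auto simp: roots_mod_def)
          then show ?thesis using 2 by simp
        qed auto
      qed
      then show "p ^ m p w dvd nat \<bar>F\<bar>"
        by (simp add: m_def R_def nat_dvd_iff flip: of_nat_power int_dvd_int_iff)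
    qed (use fin P \<open>F \<noteq> 0\<close> in auto)
    also have "\<dots> \<le> ln (C * real X ^ d)"
    proof -
      have "\<bar>F\<bar> \<le> C * int X ^ d"
        unfolding F_def C_def d_def
        by (rule abs_homogenize_le) (use w in \<open>auto simp: U_def B_def \<alpha>_def \<beta>_def\<close>)
      then have "real_of_int \<bar>F\<bar> \<le> real_of_int (C * int X ^ d)" by (subst of_int_le_iff)
      then have "real (nat \<bar>F\<bar>) \<le> C * real X ^ d" by simp
      then show ?thesis using \<open>F \<noteq> 0\<close> by (intro ln_mono) auto
    qed
    also have "\<dots> = M" using C X by (simp add: ln_mult ln_realpow M_def)
    finally show ?thesis .
  qed
  have lower: "card (roots_mod g p) * (real X ^ 4 / p - real X ^ 2) \<le> (\<Sum>w\<in>U. real (m p w))"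
    if p: "p \<in> P" for p
  proof -
    have p0: "p > 0" using P[OF p] prime_gt_0_nat by blast
    have "(\<Sum>w\<in>U. m p w) = (\<Sum>r\<in>roots_mod g p. card {w \<in> U. int p dvd \<alpha> w - int r * \<beta> w})"
      unfolding m_def by (rule sum_card_filter_swap) (simp_all add: fin)
    moreover have "real X ^ 4 / p - real X ^ 2 \<le> card {w \<in> U. int p dvd \<alpha> w - int r * \<beta> w}" for r
    proof -
      \<comment> \<open>The linear form modulo \<open>p\<close> whose kernel is the lattice of
        \<open>r\<close>. It takes at most \<open>p\<close> values, and points collide exactly when
        their difference is in the lattice.\<close>
      define f where "f = (\<lambda>u::nat \<times> nat. (int (fst u) - int r * int (snd u)) mod int p)"
      define W where "W = {(u, v) \<in> B \<times> B. f u = f v}"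
      have finW: "finite W" unfolding W_def by (rule finite_subset[of _ "B \<times> B"]) (auto simp: fin)
      have "card (f ` B) \<le> card {0..<int p}"
        using p0 by (intro card_mono) (auto simp: f_def)
      then have "real (card B) ^ 2 \<le> p * real (card W)"
        unfolding W_def by (intro card_collisions_ge fin) auto
      then have le: "real X ^ 4 / p \<le> card W"
        using p0 by (simp add: B_def field_simps power2_eq_square power4_eq_xxxx)
      \<comment> \<open>Only the \<open>X^2\<close> diagonal pairs are lost; they must be excluded
        because the form vanishes at the origin.\<close>
      have "W \<subseteq> {w \<in> U. int p dvd \<alpha> w - int r * \<beta> w} \<union> (\<lambda>u. (u, u)) ` B"
      proof
        fix w assume w: "w \<in> W"
        obtain a b c e where we: "w = ((a, b), (c, e))" by (metis prod.collapse)
        have "int p dvd (int a - int r * int b) - (int c - int r * int e)"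
          using w by (auto simp: W_def we f_def mod_eq_dvd_iff)
        then have "int p dvd \<alpha> w - int r * \<beta> w"
          by (simp add: we \<alpha>_def \<beta>_def algebra_simps)
        then show "w \<in> {w \<in> U. int p dvd \<alpha> w - int r * \<beta> w} \<union> (\<lambda>u. (u, u)) ` B"
          using w by (auto simp: W_def U_def we)
      qed
      then have "card W \<le> card ({w \<in> U. int p dvd \<alpha> w - int r * \<beta> w} \<union> (\<lambda>u. (u, u)) ` B)"
        using fin by (intro card_mono) auto
      also have "\<dots> \<le> card {w \<in> U. int p dvd \<alpha> w - int r * \<beta> w} + card ((\<lambda>u. (u, u)) ` B)"
        by (rule card_Un_le)
      also have "card ((\<lambda>u. (u, u)) ` B) \<le> card B" by (rule card_image_le[OF fin(1)])
      also have "card B = X ^ 2" by (simp add: B_def power2_eq_square)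
      finally have "card W \<le> card {w \<in> U. int p dvd \<alpha> w - int r * \<beta> w} + X ^ 2" by simp
      then have "real (card W) \<le> real (card {w \<in> U. int p dvd \<alpha> w - int r * \<beta> w} + X ^ 2)"
        by (subst of_nat_le_iff)
      then show ?thesis using le by simp
    qed
    then have "(\<Sum>r\<in>roots_mod g p. real X ^ 4 / p - real X ^ 2)
        \<le> (\<Sum>r\<in>roots_mod g p. real (card {w \<in> U. int p dvd \<alpha> w - int r * \<beta> w}))"
      by (intro sum_mono)
    ultimately show ?thesis by (simp flip: of_nat_sum)
  qed
  have lnp: "ln (real p) \<ge> 0" if "p \<in> P" for p
    using prime_ge_1_nat[OF P[OF that]] by simp
  have "(\<Sum>p\<in>P. ln p * (card (roots_mod g p) * (real X ^ 4 / p - real X ^ 2)))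
      \<le> (\<Sum>p\<in>P. ln p * (\<Sum>w\<in>U. real (m p w)))"
    by (intro sum_mono mult_left_mono lower lnp)
  also have "\<dots> = (\<Sum>w\<in>U. \<Sum>p\<in>P. real (m p w) * ln p)"
    by (simp add: sum_distrib_left mult.commute) (rule sum.swap)
  also have "\<dots> \<le> (\<Sum>w\<in>U. M)" by (intro sum_mono upper)
  also have "\<dots> = card U * M" by simp
  also have "card U \<le> card (B \<times> B)"
    unfolding U_def by (intro card_mono) (auto simp: fin)
  then have "card U * M \<le> X ^ 4 * M"
    by (intro mult_right_mono M0) (auto simp: B_def power4_eq_xxxx simp flip: of_nat_mult)
  finally have *: "(\<Sum>p\<in>P. ln p * (card (roots_mod g p) * (real X ^ 4 / p - real X ^ 2))) \<le> X ^ 4 * M"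
    by simp
  \<comment> \<open>The total cost of the diagonal pairs: with at most \<open>d\<close> roots per
    prime and the Chebyshev bound at \<open>X^2\<close> it is again of order \<open>X^4\<close>,
    without a logarithm.\<close>
  have "(\<Sum>p\<in>P. card (roots_mod g p) * (ln p * real X ^ 2)) \<le> (\<Sum>p\<in>P. d * (ln p * real X ^ 2))"
    using card_roots_mod_le[OF prim P] lnp by (intro sum_mono mult_right_mono) (auto simp: d_def)
  also have "\<dots> = d * real X ^ 2 * (\<Sum>p\<in>P. ln p)"
    unfolding sum_distrib_left by (intro sum.cong) auto
  also have "\<dots> \<le> d * real X ^ 2 * (real (X ^ 2) * ln 4)"
    unfolding P_def by (intro mult_left_mono sum_ln_primes_upto_le) auto
  finally have **: "(\<Sum>p\<in>P. card (roots_mod g p) * (ln p * real X ^ 2)) \<le> real X ^ 4 * (d * ln 4)"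
    by (simp add: power4_eq_xxxx power2_eq_square algebra_simps)
  have "real X ^ 4 * (\<Sum>p\<in>P. card (roots_mod g p) * (ln p / p)) =
      (\<Sum>p\<in>P. ln p * (card (roots_mod g p) * (real X ^ 4 / p - real X ^ 2))) +
      (\<Sum>p\<in>P. card (roots_mod g p) * (ln p * real X ^ 2))"
    unfolding sum_distrib_left sum.distrib [symmetric]
    by (intro sum.cong) (auto simp: algebra_simps)
  also have "\<dots> \<le> real X ^ 4 * (M + d * ln 4)"
    using * ** by (simp add: algebra_simps)
  finally show ?thesis
    using X by (simp add: P_def M_def C_def d_def)
qed

subsection \<open>Roots modulo prime powers\<close>

lemma poly_taylor2:
  fixes g :: "'a::idom poly"
  shows "\<exists>q. poly g y = poly g x + (y - x) * poly (pderiv g) x + (y - x) ^ 2 * q"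
proof (induction g)
  case (pCons a g)
  then obtain q where q: "poly g y = poly g x + (y - x) * poly (pderiv g) x + (y - x) ^ 2 * q"
    by blast
  show ?case
    by (rule exI[of _ "poly (pderiv g) x + y * q"])
      (simp add: pderiv_pCons q algebra_simps power2_eq_square)
qed simp

text \<open>
  The Bezout identity bounds the \<open>p\<close>-adic valuation of \<open>g'\<close> at roots modulo high powers of \<open>p\<close>.
  It serves as a weak form of Hensel's lemma that also covers the primes dividing the discriminant.
\<close>
lemma prime_power_dvd_diff_roots:
  fixes p x y :: int
  assumes p: "prime p" and bez: "u * g + v * pderiv g = [:D:]" and D: "D \<noteq> 0"
    and e: "e = multiplicity p D"
    and x: "p ^ k dvd poly g x" and y: "p ^ k dvd poly g y" and xy: "p ^ (e + 1) dvd y - x"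
  shows "p ^ (k - e) dvd y - x"
proof (cases "k \<le> e \<or> y = x")
  \<comment> \<open>The other cases are trivial: for \<open>k \<le> e\<close> the truncated
    difference \<open>k - e\<close> is 0, and everything divides \<open>y - x = 0\<close>.\<close>
  case False
  obtain q where q: "poly g y = poly g x + (y - x) * poly (pderiv g) x + (y - x) ^ 2 * q"
    using poly_taylor2 by blast
  define h where "h = poly (pderiv g) x + (y - x) * q"
  have "poly g y - poly g x = (y - x) * h"
    unfolding q h_def by (simp add: algebra_simps power2_eq_square)
  moreover have "p ^ k dvd poly g y - poly g x"
    using y x by (rule dvd_diff)
  ultimately have dvd: "p ^ k dvd (y - x) * h" by simp
  have "p ^ (e + 1) dvd p ^ k"
    using False by (intro le_imp_power_dvd) auto
  then have ek: "p ^ (e + 1) dvd poly g x"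
    using x by (rule dvd_trans)
  \<comment> \<open>Modulo \<open>p ^ (e + 1)\<close> the cofactor \<open>h\<close> equals the
    derivative at \<open>x\<close>. If both this and \<open>poly g x\<close> vanished there, the
    Bezout identity would force \<open>p ^ (e + 1)\<close> to divide \<open>D\<close>. So
    \<open>h\<close> takes at most \<open>e\<close> of the \<open>k\<close> factors
    \<open>p\<close>.\<close>
  have not: "\<not> p ^ (e + 1) dvd h"
  proof
    assume "p ^ (e + 1) dvd h"
    then have "p ^ (e + 1) dvd poly (pderiv g) x"
      using dvd_mult2[OF xy, of q] unfolding h_def by (simp only: dvd_add_left_iff)
    then have "p ^ (e + 1) dvd poly u x * poly g x + poly v x * poly (pderiv g) x"
      using ek by (intro dvd_add dvd_mult)
    also have "\<dots> = D"
      using arg_cong[OF bez, of "\<lambda>r. poly r x"] by simp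
    finally have "e + 1 \<le> multiplicity p D"
      using p D by (intro multiplicity_geI) auto
    then show False by (simp add: e)
  qed
  then have h0: "h \<noteq> 0" by auto
  have "multiplicity p h \<le> e"
    using not multiplicity_dvd'[of "e + 1" p h] by linarith
  moreover have "k \<le> multiplicity p ((y - x) * h)"
    using dvd h0 False p by (intro multiplicity_geI) auto
  ultimately have "k - e \<le> multiplicity p (y - x)"
    using h0 False prime_elem_multiplicity_mult_distrib[OF prime_imp_prime_elem[OF p], of "y - x" h]
    by simp
  then show ?thesis by (rule multiplicity_dvd')
qed auto

lemma card_congruent_le:
  fixes S :: "nat set" and N m :: nat
  assumes "S \<subseteq> {1..N}" "m > 0" "\<And>x y. x \<in> S \<Longrightarrow> y \<in> S \<Longrightarrow> int m dvd int y - int x"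
  shows "real (card S) \<le> N / m + 1"
proof -
  have "inj_on (\<lambda>x. x div m) S"
  proof (rule inj_onI)
    fix x y assume xy: "x \<in> S" "y \<in> S" "x div m = y div m"
    then have "int y mod int m = int x mod int m"
      using assms(3) by (simp add: mod_eq_dvd_iff)
    then have "y mod m = x mod m" by (simp flip: zmod_int)
    with xy(3) show "x = y" by (metis div_mult_mod_eq)
  qed
  moreover have "(\<lambda>x. x div m) ` S \<subseteq> {0..N div m}"
    using assms(1) by (force intro: div_le_mono)
  ultimately have "card S \<le> card {0..N div m}"
    by (intro card_inj_on_le) auto
  then have "real (card S) \<le> real (N div m) + 1" by simp
  also have "real (N div m) \<le> N / m" by (rule of_nat_div_le_of_nat)
  finally show ?thesis by simp
qed

text \<open>Two moduli are kept apart: \<open>q\<close> counts the classes, \<open>m\<close> gives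
  the spacing inside a class. For prime powers the class modulus \<open>p ^ (e + 1)\<close> stays
  bounded or has few root classes, while the spacing \<open>p ^ (k - e)\<close> grows with
  \<open>k\<close>.\<close>

lemma card_le_classes:
  fixes T :: "nat set" and N m q :: nat
  assumes "T \<subseteq> {1..N}" "m > 0"
    and "\<And>x y. x \<in> T \<Longrightarrow> y \<in> T \<Longrightarrow> int q dvd int y - int x \<Longrightarrow> int m dvd int y - int x"
  shows "real (card T) \<le> card ((\<lambda>n. n mod q) ` T) * (N / m + 1)"
proof -
  define F where "F = (\<lambda>c. {n \<in> T. n mod q = c})"
  have fin: "finite T" using assms(1) finite_subset by blast
  have "T = (\<Union>c\<in>(\<lambda>n. n mod q) ` T. F c)" by (auto simp: F_def)
  then have "card T = card (\<Union>c\<in>(\<lambda>n. n mod q) ` T. F c)" by simp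
  also have "\<dots> \<le> (\<Sum>c\<in>(\<lambda>n. n mod q) ` T. card (F c))"
    by (rule card_UN_le) (simp add: fin)
  finally have "real (card T) \<le> (\<Sum>c\<in>(\<lambda>n. n mod q) ` T. real (card (F c)))"
    by (metis of_nat_le_iff of_nat_sum)
  also have "\<dots> \<le> (\<Sum>c\<in>(\<lambda>n. n mod q) ` T. N / m + 1)"
  proof (intro sum_mono card_congruent_le)
    fix c x y assume "x \<in> F c" "y \<in> F c"
    then show "int m dvd int y - int x"
      using assms(3)[of x y] by (auto simp: F_def mod_eq_dvd_iff simp flip: mod_eq_dvd_iff zmod_int)
  qed (use assms in \<open>auto simp: F_def\<close>)
  finally show ?thesis by simp
qed

lemma roots_mod_if_dvd:
  assumes "int p dvd poly g (int n)" "p > 0"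
  shows "n mod p \<in> roots_mod g p"
proof -
  have "int p dvd int n - int (n mod p)"
    by (simp add: zmod_int mod_eq_dvd_iff [symmetric])
  moreover obtain q where "poly g (int n) = poly g (int (n mod p)) +
      (int n - int (n mod p)) * poly (pderiv g) (int (n mod p)) + (int n - int (n mod p)) ^ 2 * q"
    using poly_taylor2 by blast
  ultimately have "int p dvd poly g (int (n mod p))"
    using assms(1) by (simp add: power2_eq_square dvd_add_left_iff)
  then show ?thesis using assms(2) by (simp add: roots_mod_def)
qed

lemma card_roots_upto_le:
  fixes N p :: nat
  assumes "p > 0"
  shows "real (card {n \<in> {1..N}. int p dvd poly g (int n)}) \<le> card (roots_mod g p) * (N / p + 1)"
proof -
  define T where "T = {n \<in> {1..N}. int p dvd poly g (int n)}"
  have "real (card T) \<le> card ((\<lambda>n. n mod p) ` T) * (N / p + 1)"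
    by (rule card_le_classes) (auto simp: T_def assms)
  also have "\<dots> \<le> card (roots_mod g p) * (N / p + 1)"
  proof (intro mult_right_mono of_nat_mono card_mono)
    show "(\<lambda>n. n mod p) ` T \<subseteq> roots_mod g p"
      using assms by (auto simp: T_def intro!: roots_mod_if_dvd)
  qed auto
  finally show ?thesis by (simp add: T_def)
qed

text \<open>The constant is uniform in \<open>p\<close> and \<open>k\<close>. If \<open>p\<close>
  does not divide \<open>D\<close>, there are at most \<open>degree g\<close> classes modulo
  \<open>p\<close>; otherwise \<open>e \<ge> 1\<close> and the class modulus is
  \<open>p ^ e * p \<le> D^2\<close>. The further factor \<open>\<bar>D\<bar> \<ge> p ^ e\<close>
  pays for replacing the spacing \<open>p ^ (k - e)\<close> by \<open>p ^ k\<close>.\<close>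

lemma card_prime_power_roots_le:
  fixes N p k :: nat
  assumes prim: "content g = 1" and p: "prime p"
    and bez: "u * g + v * pderiv g = [:D:]" and D: "D \<noteq> 0" and k: "k \<ge> 1"
  shows "real (card {n \<in> {1..N}. int p ^ k dvd poly g (int n)}) \<le>
           (degree g + real_of_int \<bar>D\<bar> ^ 2) * real_of_int \<bar>D\<bar> * (N / p ^ k + 1)"
proof -
  define e where "e = multiplicity (int p) D"
  define T where "T = {n \<in> {1..N}. int p ^ k dvd poly g (int n)}"
  define q where "q = p ^ (e + 1)"
  have p0: "p > 0" using p prime_gt_0_nat by blast
  have "int p ^ e dvd D" unfolding e_def by (rule multiplicity_dvd)
  then have pe: "int p ^ e \<le> \<bar>D\<bar>" using D by (metis dvd_abs_iff zdvd_imp_le zero_less_abs_iff)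
  have "int p ^ (k - e) dvd int y - int x"
    if "x \<in> T" "y \<in> T" "int q dvd int y - int x" for x y
    using p that unfolding T_def q_def
    by (intro prime_power_dvd_diff_roots[OF _ bez D e_def]) auto
  then have "real (card T) \<le> card ((\<lambda>n. n mod q) ` T) * (N / (p ^ (k - e) :: nat) + 1)"
    using p0 by (intro card_le_classes) (auto simp: T_def)
  also have "\<dots> \<le> (degree g + real_of_int \<bar>D\<bar> ^ 2) * (\<bar>D\<bar> * (N / p ^ k + 1))"
  proof (intro mult_mono)
    show "real (card ((\<lambda>n. n mod q) ` T)) \<le> degree g + real_of_int \<bar>D\<bar> ^ 2"
    proof (cases "e = 0")
      case True
      have "(\<lambda>n. n mod q) ` T \<subseteq> roots_mod g p"
      proof (safe)
        fix n assume n: "n \<in> T"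
        have "int p dvd int p ^ k" using k by (intro dvd_power) auto
        then have "int p dvd poly g (int n)" using n dvd_trans by (auto simp: T_def)
        then show "n mod q \<in> roots_mod g p"
          using True p0 by (simp add: q_def roots_mod_if_dvd)
      qed
      then have "card ((\<lambda>n. n mod q) ` T) \<le> card (roots_mod g p)" by (intro card_mono) auto
      also have "\<dots> \<le> degree g" by (rule card_roots_mod_le[OF prim p])
      finally show ?thesis by (simp add: add_increasing2)
    next
      case False
      have "(\<lambda>n. n mod q) ` T \<subseteq> {..<q}" using p0 by (auto simp: q_def)
      then have "card ((\<lambda>n. n mod q) ` T) \<le> card {..<q}" by (intro card_mono) auto
      then have "card ((\<lambda>n. n mod q) ` T) \<le> q" by simp
      then have "int (card ((\<lambda>n. n mod q) ` T)) \<le> int q" by (subst of_nat_le_iff)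
      moreover have "int q = int p ^ e * int p" by (simp add: q_def)
      moreover have "int p \<le> int p ^ e" using p0 False by (intro self_le_power) auto
      then have "int p \<le> \<bar>D\<bar>" using pe by (rule order_trans)
      then have "int p ^ e * int p \<le> \<bar>D\<bar> * \<bar>D\<bar>" using pe by (intro mult_mono) auto
      ultimately have "int (card ((\<lambda>n. n mod q) ` T)) \<le> \<bar>D\<bar> * \<bar>D\<bar>" by linarith
      then have "real_of_int (int (card ((\<lambda>n. n mod q) ` T))) \<le> real_of_int (\<bar>D\<bar> * \<bar>D\<bar>)"
        by (subst of_int_le_iff)
      then show ?thesis by (simp add: power2_eq_square add_increasing)
    qed
    have "int p ^ k \<le> int p ^ (k - e) * int p ^ e"
      using p0 by (simp flip: power_add) (intro power_increasing, auto)
    also have "\<dots> \<le> int p ^ (k - e) * \<bar>D\<bar>" using pe by (intro mult_left_mono) auto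
    finally have "real_of_int (int p ^ k) \<le> real_of_int (int p ^ (k - e) * \<bar>D\<bar>)"
      by (subst of_int_le_iff)
    then have "real p ^ k \<le> real p ^ (k - e) * \<bar>D\<bar>" by simp
    then have "N * real p ^ k \<le> N * (real p ^ (k - e) * \<bar>D\<bar>)" by (intro mult_left_mono) auto
    then have "N / real p ^ (k - e) \<le> \<bar>D\<bar> * (N / real p ^ k)"
      using p0 by (simp add: field_simps)
    moreover have "1 \<le> real_of_int \<bar>D\<bar>" using D by linarith
    ultimately show "N / (p ^ (k - e) :: nat) + 1 \<le> \<bar>D\<bar> * (N / p ^ k + 1)"
      by (simp add: distrib_left)
  qed auto
  finally show ?thesis by (simp add: T_def mult.assoc)
qed

subsection \<open>Passing to a primitive integer factor\<close>

abbreviation rat_poly :: "int poly \<Rightarrow> rat poly" where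
  "rat_poly \<equiv> map_poly of_int"

lemma rat_poly_add: "rat_poly (p + q) = rat_poly p + rat_poly q"
  by (rule poly_eqI) (simp add: coeff_map_poly)

lemma rat_poly_mult: "rat_poly (p * q) = rat_poly p * rat_poly q"
  by (rule poly_eqI) (simp add: coeff_map_poly coeff_mult)

lemma rat_poly_smult: "rat_poly (smult c p) = smult (of_int c) (rat_poly p)"
  by (rule poly_eqI) (simp add: coeff_map_poly)

lemma rat_poly_pderiv: "rat_poly (pderiv p) = pderiv (rat_poly p)"
  by (rule poly_eqI) (simp add: coeff_map_poly coeff_pderiv)

lemma rat_poly_eq_iff: "rat_poly p = rat_poly q \<longleftrightarrow> p = q"
  by (auto simp: poly_eq_iff coeff_map_poly)

lemma degree_rat_poly: "degree (rat_poly p) = degree p"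
  by (rule degree_map_poly) simp

lemma clear_denominators:
  obtains c H where "c \<noteq> 0" "smult (of_int c) h = rat_poly H"
proof -
  have "\<exists>c H. c \<noteq> 0 \<and> smult (of_int c) h = rat_poly H"
  proof (induction h)
    case 0
    show ?case by (intro exI[of _ 1] exI[of _ 0]) simp
  next
    case (pCons a h)
    then obtain c H where cH: "c \<noteq> 0" "smult (of_int c) h = rat_poly H" by blast
    obtain n d where nd: "a = of_int n / of_int d" "d > 0"
      by (metis quotient_of_div quotient_of_denom_pos surj_pair)
    have "smult (of_int (c * d)) (pCons a h) = rat_poly (pCons (c * n) (smult d H))"
      using nd cH(2) [symmetric]
      by (simp add: map_poly_pCons rat_poly_smult mult.commute)
    then show ?case using cH(1) nd(2) by (metis mult_eq_0_iff less_irrefl)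
  qed
  then show thesis using that by blast
qed

lemma irreducible_no_root:
  fixes h :: "'a::field poly"
  assumes "irreducible h" "degree h \<ge> 2"
  shows "poly h x \<noteq> 0"
proof
  assume "poly h x = 0"
  then obtain k where k: "h = [:-x, 1:] * k" by (auto simp: poly_eq_0_iff_dvd elim: dvdE)
  then have "is_unit [:-x, 1:] \<or> is_unit k" using assms(1) irreducibleD by blast
  then have "is_unit k" by (auto simp: is_unit_iff_degree)
  moreover from this have "k \<noteq> 0" by auto
  ultimately have "degree k = 0" by (simp add: is_unit_iff_degree)
  then have "degree h = 1" unfolding k using \<open>k \<noteq> 0\<close> by (subst degree_mult_eq) auto
  then show False using assms(2) by simp
qed

text \<open>For \<open>b \<noteq> 0\<close> the value is \<open>b ^ degree g\<close> times the value
  of \<open>g\<close> at the rational number \<open>a / b\<close>; for \<open>b = 0\<close> only the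
  leading term survives.\<close>

lemma homogenize_eq_0_iff:
  assumes "degree g > 0" "\<And>x. poly (rat_poly g) x \<noteq> 0"
  shows "homogenize g a b = 0 \<longleftrightarrow> a = 0 \<and> b = 0"
proof (cases "b = 0")
  case True
  have "homogenize g a b = (\<Sum>i\<in>{degree g}. coeff g i * a ^ i * b ^ (degree g - i))"
    unfolding homogenize_def using True by (intro sum.mono_neutral_right) auto
  then show ?thesis using True assms(1) by auto
next
  case False
  have "of_int (homogenize g a b) = (of_int b :: rat) ^ degree g * poly (rat_poly g) (of_int a / of_int b)"
  proof -
    have "of_int (homogenize g a b) =
        (\<Sum>i\<le>degree g. (of_int b :: rat) ^ degree g * (of_int (coeff g i) * (of_int a / of_int b) ^ i))"
      unfolding homogenize_def of_int_sum
    proof (rule sum.cong)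
      fix i assume "i \<in> {..degree g}"
      then have "(of_int b :: rat) ^ degree g = of_int b ^ i * of_int b ^ (degree g - i)"
        by (simp flip: power_add)
      then show "of_int (coeff g i * a ^ i * b ^ (degree g - i)) =
          (of_int b :: rat) ^ degree g * (of_int (coeff g i) * (of_int a / of_int b) ^ i)"
        using False by (simp add: power_divide)
    qed simp
    then show ?thesis
      by (simp add: poly_altdef degree_rat_poly coeff_map_poly sum_distrib_left)
  qed
  then have "of_int (homogenize g a b) \<noteq> (0 :: rat)"
    using False assms(2) by simp
  then show ?thesis using False by auto
qed

text \<open>In characteristic 0 an irreducible polynomial is coprime to its derivative; clearing
  denominators in the Bezout identity produces \<open>D\<close>, which takes the place of the
  discriminant.\<close>

lemma bezout_pderiv:
  assumes "irreducible (rat_poly g)" "degree g > 0"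
  obtains u v D where "u * g + v * pderiv g = [:D:]" "D \<noteq> 0"
proof -
  define h where "h = rat_poly g"
  have "prime_elem h" unfolding h_def by (rule field_poly_irreducible_imp_prime[OF assms(1)])
  moreover have "\<not> h dvd pderiv h" using assms(2) by (simp add: h_def degree_rat_poly)
  ultimately have "coprime h (pderiv h)" by (rule prime_elem_imp_coprime)
  then have "gcd h (pderiv h) = 1" by simp
  then obtain a b where ab: "a * h + b * pderiv h = 1"
    by (metis bezout_coefficients_fst_snd)
  obtain c U where U: "c \<noteq> 0" "smult (of_int c) a = rat_poly U" by (rule clear_denominators)
  obtain e V where V: "e \<noteq> 0" "smult (of_int e) b = rat_poly V" by (rule clear_denominators)
  have "rat_poly (smult e U * g + smult c V * pderiv g) =
      smult (of_int (c * e)) (a * h + b * pderiv h)"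
    by (simp add: rat_poly_add rat_poly_mult rat_poly_smult rat_poly_pderiv smult_add_right
        mult.commute flip: h_def U(2) V(2))
  also have "\<dots> = rat_poly [:c * e:]" unfolding ab by (simp add: map_poly_pCons)
  finally have "smult e U * g + smult c V * pderiv g = [:c * e:]"
    by (simp only: rat_poly_eq_iff)
  then show thesis using U(1) V(1) by (intro that[of "smult e U" "smult c V" "c * e"]) auto
qed

text \<open>Denominators are cleared in both \<open>h\<close> and its cofactor, which yields
  divisibility of a multiple of \<open>f\<close>. The fixed factor \<open>m\<close> later changes
  the logarithm of the least common multiple only by a constant.\<close>

lemma primitive_int_factor:
  fixes f :: "int poly"
  assumes "h dvd rat_poly f" "irreducible h"
  obtains g m where "content g = 1" "degree g = degree h" "irreducible (rat_poly g)"
    "g dvd smult m f" "m \<noteq> 0"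
proof -
  obtain k where k: "rat_poly f = h * k" using assms(1) by (elim dvdE)
  obtain c H where H: "c \<noteq> 0" "smult (of_int c) h = rat_poly H" by (rule clear_denominators)
  obtain e K where K: "e \<noteq> 0" "smult (of_int e) k = rat_poly K" by (rule clear_denominators)
  define g where "g = primitive_part H"
  have H_eq: "H = smult (content H) g" unfolding g_def by simp
  have "h \<noteq> 0" using assms(2) by auto
  then have "H \<noteq> 0" using H by auto
  have "rat_poly (smult (c * e) f) = rat_poly (H * K)"
    by (simp add: rat_poly_smult rat_poly_mult k mult.commute flip: H(2) K(2))
  then have "smult (c * e) f = g * smult (content H) K"
    using H_eq by (metis rat_poly_eq_iff mult_smult_left mult_smult_right)
  then have dvd: "g dvd smult (c * e) f" by (metis dvd_triv_left)
  have "content H \<noteq> 0" using \<open>H \<noteq> 0\<close> by simp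
  have "smult (of_int c) h = smult (of_int (content H)) (rat_poly g)"
    unfolding H(2) by (subst H_eq) (rule rat_poly_smult)
  then have "[:of_int c:] * h = [:of_int (content H):] * rat_poly g" by simp
  moreover have "is_unit [:rat_of_int c:]" "is_unit [:rat_of_int (content H):]"
    using H(1) \<open>content H \<noteq> 0\<close> by (auto simp: is_unit_const_poly_iff dvd_field_iff)
  ultimately have irr: "irreducible (rat_poly g)"
    using assms(2) by (metis irreducible_mult_unit_left)
  have "degree h = degree (smult (of_int c) h)" using H(1) by simp
  also have "\<dots> = degree g" unfolding H(2) by (simp add: degree_rat_poly g_def)
  finally have deg: "degree g = degree h" by simp
  have "content g = 1" using \<open>H \<noteq> 0\<close> by (simp add: g_def)
  then show thesis using deg irr dvd H(1) K(1) by (intro that[of g "c * e"]) auto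
qed

subsection \<open>The contribution of the small primes\<close>

lemma sum_powers_from_2_le:
  fixes x :: real
  assumes "0 \<le> x" "x \<le> 1 / 2"
  shows "(\<Sum>k\<in>{2..K}. x ^ k) \<le> 2 * x ^ 2"
proof -
  \<comment> \<open>The induction carries a bound for the remaining geometric tail: twice the next
    power pays for that power and, as \<open>2 * x \<le> 1\<close>, for the new tail term.\<close>
  have *: "(\<Sum>k\<in>{2..Suc K}. x ^ k) + 2 * x ^ Suc (Suc K) \<le> 2 * x ^ 2" for K
  proof (induction K)
    case (Suc K)
    have "2 * x ^ Suc (Suc (Suc K)) = x ^ Suc (Suc K) * (2 * x)" by simp
    also have "\<dots> \<le> x ^ Suc (Suc K) * 1"
      using assms by (intro mult_left_mono) auto
    finally show ?case using Suc by simp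
  qed (use assms in \<open>simp add: power2_eq_square\<close>)
  show ?thesis
  proof (cases K)
    case (Suc K')
    moreover have "0 \<le> 2 * x ^ Suc (Suc K')" using assms by (intro mult_nonneg_nonneg) auto
    ultimately show ?thesis using *[of K'] unfolding Suc by linarith
  qed simp
qed

lemma multiplicity_eq_card:
  fixes p x :: nat
  assumes "prime p" "x > 0" "multiplicity p x \<le> K"
  shows "multiplicity p x = card {k \<in> {1..K}. p ^ k dvd x}"
proof -
  have iff: "p ^ k dvd x \<longleftrightarrow> k \<le> multiplicity p x" for k
    using assms(1,2) not_prime_unit[of p] by (intro power_dvd_iff_le_multiplicity) auto
  have "{k \<in> {1..K}. p ^ k dvd x} = {1..multiplicity p x}"
    unfolding iff using assms(3) by auto
  then show ?thesis by simp
qed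

text \<open>As in Legendre's formula, the multiplicities are summed by counting, for each
  \<open>k\<close>, the arguments whose value is divisible by \<open>p ^ k\<close>. The case
  \<open>k = 1\<close> keeps the sharp constant \<open>A\<close>, since it gives the main term; for
  \<open>k \<ge> 2\<close> a crude \<open>B\<close> suffices.\<close>

lemma sum_multiplicity_le:
  fixes x :: "nat \<Rightarrow> nat" and p N :: nat and A B M :: real
  assumes p: "prime p" and x: "\<And>n. n \<in> {1..N} \<Longrightarrow> x n > 0"
    and M: "\<And>n. n \<in> {1..N} \<Longrightarrow> ln (x n) \<le> M" "M \<ge> 0"
    and first: "card {n \<in> {1..N}. p dvd x n} \<le> A * (N / p + 1)"
    and higher: "\<And>k. k \<ge> 1 \<Longrightarrow> card {n \<in> {1..N}. p ^ k dvd x n} \<le> B * (N / p ^ k + 1)"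
    and B: "B \<ge> 0"
  shows "(\<Sum>n\<in>{1..N}. real (multiplicity p (x n)) * ln p) \<le>
           A * (N * (ln p / p)) + A * ln p + 2 * B * N * (ln p / p ^ 2) + B * M"
proof -
  \<comment> \<open>No exponent exceeds \<open>M / ln p\<close>, so the \<open>K\<close> copies of
    the summand 1 in the higher counts contribute at most \<open>B * M\<close> after multiplication
    by \<open>ln p\<close>.\<close>
  define K where "K = nat \<lfloor>M / ln p\<rfloor>"
  have p2: "p \<ge> 2" using p prime_ge_2_nat by blast
  then have lnp: "ln (real p) > 0" by simp
  have K: "K * ln p \<le> M"
  proof -
    have "real K \<le> M / ln p"
      unfolding K_def using lnp M(2) by (intro of_nat_floor) auto
    then show ?thesis using lnp by (simp add: pos_le_divide_eq)
  qed
  have mult: "multiplicity p (x n) = card {k \<in> {1..K}. p ^ k dvd x n}" if n: "n \<in> {1..N}" for n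
  proof (rule multiplicity_eq_card[OF p x[OF n]])
    have "(\<Sum>q\<in>{p}. real (multiplicity q (x n)) * ln q) \<le> ln (x n)"
      using x[OF n] p by (intro sum_ln_primes_le) (auto simp: multiplicity_dvd)
    then have "real (multiplicity p (x n)) * ln p \<le> M" using M(1)[OF n] by simp
    then have "real (multiplicity p (x n)) \<le> M / ln p" using lnp by (simp add: pos_le_divide_eq)
    then show "multiplicity p (x n) \<le> K" unfolding K_def by (rule le_nat_floor)
  qed
  have "(\<Sum>n\<in>{1..N}. multiplicity p (x n)) = (\<Sum>k\<in>{1..K}. card {n \<in> {1..N}. p ^ k dvd x n})"
    using sum_card_filter_swap[of "{1..N}" "{1..K}" "\<lambda>n k. p ^ k dvd x n"] mult by simp
  \<comment> \<open>An inequality because \<open>K\<close> may be 0, when the range on the left is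
    empty.\<close>
  also have "\<dots> \<le> (\<Sum>k\<in>insert 1 {2..K}. card {n \<in> {1..N}. p ^ k dvd x n})"
    by (intro sum_mono2) auto
  also have "\<dots> = card {n \<in> {1..N}. p dvd x n} + (\<Sum>k\<in>{2..K}. card {n \<in> {1..N}. p ^ k dvd x n})"
    by simp
  finally have "real (\<Sum>n\<in>{1..N}. multiplicity p (x n)) \<le>
      real (card {n \<in> {1..N}. p dvd x n} + (\<Sum>k\<in>{2..K}. card {n \<in> {1..N}. p ^ k dvd x n}))"
    by (subst of_nat_le_iff)
  also have "\<dots> = real (card {n \<in> {1..N}. p dvd x n}) +
      (\<Sum>k\<in>{2..K}. real (card {n \<in> {1..N}. p ^ k dvd x n}))" by simp
  also have "\<dots> \<le> A * (N / p + 1) + (\<Sum>k\<in>{2..K}. B * (N / p ^ k + 1))"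
    by (intro add_mono sum_mono first higher) auto
  also have "(\<Sum>k\<in>{2..K}. B * (N / p ^ k + 1)) = B * N * (\<Sum>k\<in>{2..K}. (1 / real p) ^ k) + B * card {2..K}"
    by (simp add: sum.distrib sum_distrib_left distrib_left power_divide del: card_atLeastAtMost)
  also have "\<dots> \<le> B * N * (2 * (1 / real p) ^ 2) + B * K"
    using p2 B by (intro add_mono mult_left_mono sum_powers_from_2_le) (auto simp: field_simps)
  finally have "real (\<Sum>n\<in>{1..N}. multiplicity p (x n)) \<le>
      A * (N / p + 1) + (B * N * (2 * (1 / real p) ^ 2) + B * K)" by simp
  then have "real (\<Sum>n\<in>{1..N}. multiplicity p (x n)) * ln p \<le>
      (A * (N / p + 1) + (B * N * (2 * (1 / real p) ^ 2) + B * K)) * ln p"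
    using lnp by (intro mult_right_mono) auto
  also have "\<dots> = A * (N * (ln p / p)) + A * ln p + 2 * B * N * (ln p / p ^ 2) + B * (K * ln p)"
    by (simp add: algebra_simps power_divide)
  also have "B * (K * ln p) \<le> B * M" using K B by (intro mult_left_mono)
  finally show ?thesis by (simp add: sum_distrib_right)
qed

lemma abs_poly_le:
  fixes f :: "int poly" and n N :: nat
  assumes "1 \<le> n" "n \<le> N"
  shows "\<bar>poly f (int n)\<bar> \<le> (\<Sum>i\<le>degree f. \<bar>coeff f i\<bar>) * int N ^ degree f"
proof -
  have "poly f (int n) = homogenize f (int n) 1"
    using homogenize_mult_left[of f "int n" 1] by simp
  then show ?thesis using assms abs_homogenize_le[of "int n" "int N" 1 f] by simp
qed

lemma ln_abs_poly_le:
  fixes f :: "int poly" and n N :: nat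
  assumes "1 \<le> n" "n \<le> N" "poly f (int n) \<noteq> 0"
  shows "ln (real (nat \<bar>poly f (int n)\<bar>)) \<le> ln (real_of_int (\<Sum>i\<le>degree f. \<bar>coeff f i\<bar>)) + degree f * ln N"
proof -
  define C where "C = (\<Sum>i\<le>degree f. \<bar>coeff f i\<bar>)"
  have "f \<noteq> 0" using assms(3) by auto
  then have C: "C \<ge> 1" unfolding C_def by (rule sum_abs_coeff_ge_1)
  have "real_of_int \<bar>poly f (int n)\<bar> \<le> real_of_int (C * int N ^ degree f)"
    using abs_poly_le[OF assms(1,2), of f] unfolding C_def by (subst of_int_le_iff)
  then have "real (nat \<bar>poly f (int n)\<bar>) \<le> C * real N ^ degree f" by simp
  then have "ln (real (nat \<bar>poly f (int n)\<bar>)) \<le> ln (C * real N ^ degree f)"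
    using assms(3) by (intro ln_mono) auto
  also have "\<dots> = ln C + degree f * ln N"
    using C assms by (simp add: ln_mult ln_realpow)
  finally show ?thesis by (simp add: C_def)
qed

text \<open>The main term is \<open>N\<close> times the weighted root sum over primes up to
  \<open>N\<close>. Bounding that sum with \<open>X\<close> about \<open>sqrt N\<close> turns
  \<open>ln X\<close> into \<open>ln N / 2\<close>, the source of the factor 1/2.\<close>

lemma small_primes_contribution:
  fixes g :: "int poly"
  assumes prim: "content g = 1"
    and nz: "\<And>a b. homogenize g a b = 0 \<Longrightarrow> a = 0 \<and> b = 0"
    and bez: "u * g + v * pderiv g = [:D:]" "D \<noteq> 0"
  obtains C where "\<And>N. N \<ge> 1 \<Longrightarrow>
    (\<Sum>p\<in>primes_upto N. \<Sum>n\<in>{1..N}. real (multiplicity p (nat \<bar>poly g (int n)\<bar>)) * ln p)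
      \<le> degree g / 2 * (N * ln N) + C * N"
proof -
  define d where "d = real (degree g)"
  define x where "x = (\<lambda>n. nat \<bar>poly g (int n)\<bar>)"
  define B where "B = (d + real_of_int \<bar>D\<bar> ^ 2) * real_of_int \<bar>D\<bar>"
  define c where "c = ln (real_of_int (\<Sum>i\<le>degree g. \<bar>coeff g i\<bar>))"
  obtain Q where Q: "Q \<ge> 0" "\<And>n. (\<Sum>p\<in>primes_upto n. ln p / p ^ 2) \<le> (Q::real)"
    using sum_ln_over_square_bounded by blast
  \<comment> \<open>In order: rounding \<open>sqrt N\<close> up to \<open>X\<close>, the constant in
    the weighted root sum, the summand 1 in the count of roots modulo \<open>p\<close>, the higher
    prime powers, and the summands 1 in their counts.\<close>
  define C where "C = d * ln 2 + (c + d * ln 4) + d * ln 4 + 2 * B * Q + B * (c + d * (2 + 2 * ln 4))"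
  have "g \<noteq> 0" using prim by auto
  then have "1 \<le> real_of_int (\<Sum>i\<le>degree g. \<bar>coeff g i\<bar>)"
    using sum_abs_coeff_ge_1[of g] by linarith
  then have c0: "c \<ge> 0" unfolding c_def by (rule ln_ge_zero)
  have d0: "d \<ge> 0" by (simp add: d_def)
  have B0: "B \<ge> 0" unfolding B_def using d0 by simp
  have gnz: "poly g (int n) \<noteq> 0" for n
    using nz[of "int n" 1] homogenize_mult_left[of g "int n" 1] by auto
  have "(\<Sum>p\<in>primes_upto N. \<Sum>n\<in>{1..N}. real (multiplicity p (x n)) * ln p)
      \<le> d / 2 * (N * ln N) + C * N" if N: "N \<ge> 1" for N :: nat
  proof -
    define M where "M = c + d * ln N"
    define X where "X = nat \<lceil>sqrt N\<rceil>"
    define S where "S = (\<Sum>p\<in>primes_upto N. real (card (roots_mod g p)) * (ln p / p))"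
    have M0: "M \<ge> 0" unfolding M_def using c0 d0 N by simp
    have pr: "prime p" if "p \<in> primes_upto N" for p using that by (simp add: primes_upto_def)
    have lnp: "ln (real p) \<ge> 0" if "prime p" for p
      using prime_ge_1_nat[OF that] by simp
    have s1: "sqrt N \<ge> 1" using N by simp
    then have X1: "X \<ge> 1" unfolding X_def by linarith
    have XN: "sqrt N \<le> real X" unfolding X_def using s1 by linarith
    have "real N \<le> real X ^ 2"
      using power_mono[OF XN, of 2] N by simp
    then have NX: "N \<le> X ^ 2" by (metis of_nat_le_iff of_nat_power)
    have "real X \<le> 2 * sqrt N" unfolding X_def using s1 by linarith
    then have "ln (real X) \<le> ln (2 * sqrt N)" using X1 by (intro ln_mono) auto
    also have "\<dots> = ln 2 + ln N / 2" using N by (simp add: ln_mult ln_sqrt)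
    finally have lnX: "ln (real X) \<le> ln 2 + ln N / 2" .
    have "S \<le> (\<Sum>p\<in>primes_upto (X ^ 2). real (card (roots_mod g p)) * (ln p / p))"
      unfolding S_def using NX lnp
      by (intro sum_mono2) (auto simp: primes_upto_def)
    also have "\<dots> \<le> d * ln X + (c + d * ln 4)"
      using sum_roots_mod_le[OF prim nz X1] unfolding d_def c_def by simp
    also have "\<dots> \<le> d * (ln 2 + ln N / 2) + (c + d * ln 4)"
      using lnX d0 by (intro add_right_mono mult_left_mono)
    finally have S: "S \<le> d * (ln 2 + ln N / 2) + (c + d * ln 4)" .
    have single: "(\<Sum>n\<in>{1..N}. real (multiplicity p (x n)) * ln p) \<le>
        card (roots_mod g p) * (N * (ln p / p)) + d * ln p + 2 * B * N * (ln p / p ^ 2) + B * M"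
      if p: "p \<in> primes_upto N" for p
    proof -
      have "(\<Sum>n\<in>{1..N}. real (multiplicity p (x n)) * ln p) \<le>
        card (roots_mod g p) * (N * (ln p / p)) + card (roots_mod g p) * ln p
          + 2 * B * N * (ln p / p ^ 2) + B * M"
      proof (rule sum_multiplicity_le[OF pr[OF p] _ _ M0 _ _ B0])
        show "x n > 0" for n using gnz[of n] by (simp add: x_def)
        show "ln (real (x n)) \<le> M" if "n \<in> {1..N}" for n
          using ln_abs_poly_le[of n N g] that gnz unfolding x_def M_def c_def d_def by simp
        show "real (card {n \<in> {1..N}. p dvd x n}) \<le> card (roots_mod g p) * (N / p + 1)"
          using card_roots_upto_le[of p N g] prime_gt_0_nat[OF pr[OF p]]
          by (simp add: x_def dvd_nat_abs_iff)
        show "real (card {n \<in> {1..N}. p ^ k dvd x n}) \<le> B * (N / p ^ k + 1)" if "k \<ge> 1" for k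
          using card_prime_power_roots_le[OF prim pr[OF p] bez that, of N]
          by (simp add: x_def dvd_nat_abs_iff B_def d_def)
      qed
      also have "card (roots_mod g p) * ln p \<le> d * ln p"
        using card_roots_mod_le[OF prim pr[OF p]] lnp[OF pr[OF p]]
        by (intro mult_right_mono) (auto simp: d_def)
      finally show ?thesis by simp
    qed
    have "(\<Sum>p\<in>primes_upto N. \<Sum>n\<in>{1..N}. real (multiplicity p (x n)) * ln p) \<le>
        (\<Sum>p\<in>primes_upto N. card (roots_mod g p) * (N * (ln p / p)) + d * ln p
           + 2 * B * N * (ln p / p ^ 2) + B * M)"
      by (rule sum_mono) (use single in simp)
    also have "\<dots> = N * S + d * (\<Sum>p\<in>primes_upto N. ln p)
        + 2 * B * N * (\<Sum>p\<in>primes_upto N. ln p / p ^ 2) + card (primes_upto N) * (B * M)"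
    proof -
      have "(\<Sum>p\<in>primes_upto N. card (roots_mod g p) * (N * (ln p / p))) = N * S"
        unfolding S_def sum_distrib_left by (intro sum.cong) auto
      then show ?thesis by (simp add: sum.distrib sum_distrib_left)
    qed
    also have "\<dots> \<le> N * (d * (ln 2 + ln N / 2) + (c + d * ln 4)) + d * (N * ln 4)
        + 2 * B * N * Q + N * (B * (c + d * (2 + 2 * ln 4)))"
    proof (intro add_mono mult_left_mono S Q sum_ln_primes_upto_le)
      \<comment> \<open>The error \<open>B * M\<close> per prime contains \<open>ln N\<close>. The
        trivial count of primes suffices for the constant part of \<open>M\<close>, the Chebyshev
        count absorbs the logarithm.\<close>
      have "card (primes_upto N) \<le> card {1..N}"
        by (intro card_mono) (auto simp: primes_upto_def dest: prime_ge_1_nat)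
      then have "card (primes_upto N) * c \<le> N * c" using c0 by (intro mult_right_mono) auto
      moreover have "d * (card (primes_upto N) * ln N) \<le> d * ((2 + 2 * ln 4) * N)"
        using card_primes_upto_le[OF N] d0 by (intro mult_left_mono) auto
      ultimately have "card (primes_upto N) * M \<le> N * (c + d * (2 + 2 * ln 4))"
        by (simp add: M_def algebra_simps)
      then have "B * (card (primes_upto N) * M) \<le> B * (N * (c + d * (2 + 2 * ln 4)))"
        using B0 by (intro mult_left_mono)
      then show "card (primes_upto N) * (B * M) \<le> N * (B * (c + d * (2 + 2 * ln 4)))"
        by (simp add: mult_ac)
    qed (use d0 B0 in auto)
    also have "\<dots> = d / 2 * (N * ln N) + C * N"
      by (simp add: C_def algebra_simps)
    finally show ?thesis .
  qed
  then show thesis by (intro that) (auto simp: x_def d_def)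
qed

subsection \<open>Growth of the least common multiple\<close>

text \<open>A weak Stirling bound; the induction step rests on
  \<open>N * ln (1 + 1 / N) \<le> 1\<close>.\<close>

lemma sum_ln_ge:
  assumes "N \<ge> 1"
  shows "(\<Sum>n\<in>{1..N}. ln (real n)) \<ge> N * ln N - N"
  using assms
proof (induction N rule: nat_induct_at_least)
  case (Suc N)
  have N: "real N > 0" using Suc by simp
  have "ln (real (Suc N)) - ln N = ln (real (Suc N) / N)" using N by (simp add: ln_div)
  also have "real (Suc N) / N = 1 + 1 / N" using N by (simp add: field_simps)
  also have "ln (1 + 1 / N) \<le> 1 / N" by (rule ln_add_one_self_le_self) simp
  finally have "N * (ln (real (Suc N)) - ln N) \<le> N * (1 / N)" by (intro mult_left_mono) auto
  then have "N * (ln (real (Suc N)) - ln N) \<le> 1" using N by simp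
  moreover have "real (Suc N) * ln (real (Suc N)) - real (Suc N)
      = N * ln N - N + N * (ln (real (Suc N)) - ln N) - 1 + ln (real (Suc N))"
    by (simp add: algebra_simps)
  moreover have "(\<Sum>n\<in>{1..Suc N}. ln (real n)) = (\<Sum>n\<in>{1..N}. ln (real n)) + ln (real (Suc N))"
    by simp
  ultimately show ?case using Suc.IH by linarith
qed simp

text \<open>For \<open>n \<ge> 2 * K\<close> the lower terms amount to at most half the leading one,
  which costs \<open>ln 2\<close>. For smaller \<open>n\<close> the value is a nonzero integer and
  \<open>degree g * ln n\<close> is bounded, whence the second part of \<open>C\<close>.\<close>

lemma ln_abs_poly_ge:
  fixes g :: "int poly"
  assumes "degree g > 0" "\<And>n::nat. poly g (int n) \<noteq> 0"
  obtains C where "\<And>n. n \<ge> 1 \<Longrightarrow> ln (real (nat \<bar>poly g (int n)\<bar>)) \<ge> degree g * ln n - C"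
proof -
  define d where "d = degree g"
  define K where "K = (\<Sum>i<d. \<bar>coeff g i\<bar>)"
  define C where "C = ln 2 + d * ln (2 * real_of_int K + 1)"
  have d: "d > 0" using assms(1) by (simp add: d_def)
  have K0: "K \<ge> 0" unfolding K_def by (intro sum_nonneg) auto
  have "ln (real (nat \<bar>poly g (int n)\<bar>)) \<ge> d * ln n - C" if n: "n \<ge> 1" for n
  proof (cases "int n \<ge> 2 * K")
    case True
    have "poly g (int n) = (\<Sum>i\<in>insert d {..<d}. coeff g i * int n ^ i)"
      unfolding poly_altdef d_def by (rule sum.cong) auto
    then have eq: "poly g (int n) = coeff g d * int n ^ d + (\<Sum>i<d. coeff g i * int n ^ i)" by simp
    have "\<bar>\<Sum>i<d. coeff g i * int n ^ i\<bar> \<le> (\<Sum>i<d. \<bar>coeff g i * int n ^ i\<bar>)" by (rule sum_abs)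
    also have "\<dots> \<le> (\<Sum>i<d. \<bar>coeff g i\<bar> * int n ^ (d - 1))"
      using n by (intro sum_mono) (auto simp: abs_mult intro!: mult_left_mono power_increasing)
    also have "\<dots> = K * int n ^ (d - 1)" by (simp add: K_def sum_distrib_right)
    finally have tail: "2 * \<bar>\<Sum>i<d. coeff g i * int n ^ i\<bar> \<le> 2 * K * int n ^ (d - 1)" by simp
    also have "\<dots> \<le> int n * int n ^ (d - 1)" using True by (intro mult_right_mono) auto
    also have "\<dots> = int n ^ d" using d by (simp flip: power_Suc)
    finally have "2 * \<bar>\<Sum>i<d. coeff g i * int n ^ i\<bar> \<le> int n ^ d" .
    moreover have "coeff g d \<noteq> 0" using assms(1) by (auto simp: d_def)
    then have "\<bar>coeff g d\<bar> \<ge> 1" by linarith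
    then have "\<bar>coeff g d\<bar> * int n ^ d \<ge> 1 * int n ^ d" by (intro mult_right_mono) auto
    then have "\<bar>coeff g d * int n ^ d\<bar> \<ge> int n ^ d" by (simp add: abs_mult)
    moreover have "c \<le> 2 * \<bar>a + b\<bar>" if "2 * \<bar>b\<bar> \<le> c" "c \<le> \<bar>a\<bar>" for a b c :: int
      using that by (auto simp: abs_if split: if_splits)
    ultimately have "int n ^ d \<le> 2 * \<bar>poly g (int n)\<bar>" unfolding eq by blast
    then have "real_of_int (int n ^ d) \<le> real_of_int (2 * \<bar>poly g (int n)\<bar>)" by (subst of_int_le_iff)
    then have "real n ^ d \<le> 2 * real (nat \<bar>poly g (int n)\<bar>)" by simp
    then have "ln (real n ^ d) \<le> ln (2 * real (nat \<bar>poly g (int n)\<bar>))"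
      using n by (intro ln_mono) auto
    then have "d * ln n \<le> ln 2 + ln (real (nat \<bar>poly g (int n)\<bar>))"
      using n assms(2)[of n] by (simp add: ln_mult ln_realpow)
    moreover have "0 \<le> d * ln (2 * real_of_int K + 1)" using K0 by simp
    ultimately show ?thesis unfolding C_def by simp
  next
    case False
    then have "ln n \<le> ln (2 * real_of_int K + 1)" using n by (intro ln_mono) linarith+
    then have "d * ln n \<le> d * ln (2 * real_of_int K + 1)" by (intro mult_left_mono) auto
    moreover have "0 \<le> ln (real (nat \<bar>poly g (int n)\<bar>))" using assms(2)[of n] by simp
    moreover have "0 \<le> ln (2::real)" by simp
    ultimately show ?thesis unfolding C_def by linarith
  qed
  then show thesis by (intro that) (simp add: d_def)
qed

text \<open>For a prime \<open>p > N\<close> distinct arguments up to \<open>N\<close> are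
  incongruent, so \<open>p\<close> divides at most \<open>degree g\<close> of the values, each to a
  power no higher than in \<open>L\<close>. The subset \<open>A\<close> makes it possible to omit
  arguments at which \<open>f\<close> vanishes.\<close>

lemma sum_ln_values_le:
  fixes g :: "int poly" and L :: nat
  assumes prim: "content g = 1" and A: "A \<subseteq> {1..N}"
    and nz: "\<And>n. n \<in> A \<Longrightarrow> poly g (int n) \<noteq> 0"
    and dvd: "\<And>n. n \<in> A \<Longrightarrow> nat \<bar>poly g (int n)\<bar> dvd L" and L: "L > 0"
  shows "(\<Sum>n\<in>A. ln (real (nat \<bar>poly g (int n)\<bar>))) \<le>
    (\<Sum>p\<in>primes_upto N. \<Sum>n\<in>{1..N}. real (multiplicity p (nat \<bar>poly g (int n)\<bar>)) * ln p)
      + degree g * ln L"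
proof -
  define x where "x = (\<lambda>n. nat \<bar>poly g (int n)\<bar>)"
  define Q where "Q = (\<Union>n\<in>A. prime_factors (x n)) - primes_upto N"
  have finA: "finite A" using A finite_subset by blast
  then have finQ: "finite Q" by (simp add: Q_def)
  have Q: "prime p" "N < p" if "p \<in> Q" for p
    using that by (auto simp: Q_def primes_upto_def in_prime_factors_iff)
  have x0: "x n > 0" if "n \<in> A" for n using nz[OF that] by (simp add: x_def)
  have lnp: "ln (real p) \<ge> 0" if "prime p" for p using prime_ge_1_nat[OF that] by simp
  have "(\<Sum>n\<in>A. ln (x n)) = (\<Sum>n\<in>A. \<Sum>p\<in>primes_upto N \<union> Q. real (multiplicity p (x n)) * ln p)"
  proof (rule sum.cong)
    fix n assume n: "n \<in> A"
    have "ln (x n) = (\<Sum>p\<in>prime_factors (x n). real (multiplicity p (x n)) * ln p)"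
      by (rule ln_eq_sum_multiplicity[OF x0[OF n]])
    also have "\<dots> = (\<Sum>p\<in>primes_upto N \<union> Q. real (multiplicity p (x n)) * ln p)"
    proof (rule sum.mono_neutral_left)
      show "prime_factors (x n) \<subseteq> primes_upto N \<union> Q" using n by (auto simp: Q_def)
      show "\<forall>p\<in>primes_upto N \<union> Q - prime_factors (x n). real (multiplicity p (x n)) * ln p = 0"
        using x0[OF n] Q
        by (auto simp: in_prime_factors_iff primes_upto_def not_dvd_imp_multiplicity_0)
    qed (simp add: finQ)
    finally show "ln (x n) = (\<Sum>p\<in>primes_upto N \<union> Q. real (multiplicity p (x n)) * ln p)" .
  qed simp
  also have "\<dots> = (\<Sum>p\<in>primes_upto N \<union> Q. \<Sum>n\<in>A. real (multiplicity p (x n)) * ln p)"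
    by (rule sum.swap)
  also have "\<dots> = (\<Sum>p\<in>primes_upto N. \<Sum>n\<in>A. real (multiplicity p (x n)) * ln p) +
      (\<Sum>p\<in>Q. \<Sum>n\<in>A. real (multiplicity p (x n)) * ln p)"
    using finQ by (intro sum.union_disjoint) (auto simp: Q_def)
  also have "\<dots> \<le> (\<Sum>p\<in>primes_upto N. \<Sum>n\<in>{1..N}. real (multiplicity p (x n)) * ln p) +
      (\<Sum>p\<in>Q. degree g * (real (multiplicity p L) * ln p))"
  proof (intro add_mono sum_mono)
    fix p assume "p \<in> primes_upto N"
    then show "(\<Sum>n\<in>A. real (multiplicity p (x n)) * ln p) \<le> (\<Sum>n\<in>{1..N}. real (multiplicity p (x n)) * ln p)"
      using A lnp by (intro sum_mono2) (auto simp: primes_upto_def)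
  next
    fix p assume p: "p \<in> Q"
    define T where "T = {n \<in> A. p dvd x n}"
    have "(\<Sum>n\<in>A. real (multiplicity p (x n)) * ln p) = (\<Sum>n\<in>T. real (multiplicity p (x n)) * ln p)"
      using finA by (intro sum.mono_neutral_right) (auto simp: T_def not_dvd_imp_multiplicity_0)
    also have "\<dots> \<le> (\<Sum>n\<in>T. real (multiplicity p L) * ln p)"
    proof (intro sum_mono mult_right_mono of_nat_mono)
      fix n assume "n \<in> T"
      then have "x n dvd L" using dvd by (simp add: T_def x_def)
      then show "multiplicity p (x n) \<le> multiplicity p L"
        using L Q[OF p] by (intro dvd_imp_multiplicity_le) auto
    qed (use lnp Q p in auto)
    also have "\<dots> = card T * (real (multiplicity p L) * ln p)" by simp
    also have "\<dots> \<le> degree g * (real (multiplicity p L) * ln p)"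
    proof (intro mult_right_mono of_nat_mono)
      show "card T \<le> degree g"
      proof (rule card_incongruent_roots_le[OF prim Q(1)[OF p]])
        show "finite T" using finA by (simp add: T_def)
        show "int p dvd poly g (int s)" if "s \<in> T" for s
          using that by (simp add: T_def x_def dvd_nat_abs_iff)
        show "s = t" if "s \<in> T" "t \<in> T" "int p dvd int s - int t" for s t
          by (rule int_eq_if_dvd_diff[OF that(3)])
            (use that A Q(2)[OF p] in \<open>force simp: T_def\<close>)+
      qed
    qed (use lnp Q p in auto)
    finally show "(\<Sum>n\<in>A. real (multiplicity p (x n)) * ln p) \<le> degree g * (real (multiplicity p L) * ln p)" .
  qed
  also have "(\<Sum>p\<in>Q. degree g * (real (multiplicity p L) * ln p)) =
      degree g * (\<Sum>p\<in>Q. real (multiplicity p L) * ln p)"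
    by (simp add: sum_distrib_left)
  also have "\<dots> \<le> degree g * ln L"
    using Q finQ L by (intro mult_left_mono sum_ln_primes_le) (auto simp: multiplicity_dvd)
  finally show ?thesis by (simp add: x_def)
qed

text \<open>The least common multiple divides the product of the at most \<open>N\<close> nonzero
  values.\<close>

lemma ln_lcm_values_le:
  fixes f :: "int poly"
  assumes "f \<noteq> 0" "N \<ge> 1"
  shows "ln (real_of_int (lcm_values f N)) \<le>
    N * (ln (real_of_int (\<Sum>i\<le>degree f. \<bar>coeff f i\<bar>)) + degree f * ln N)"
proof -
  define A where "A = {n \<in> {1..N}. poly f (int n) \<noteq> 0}"
  define B where "B = ln (real_of_int (\<Sum>i\<le>degree f. \<bar>coeff f i\<bar>)) + degree f * ln N"
  have "1 \<le> real_of_int (\<Sum>i\<le>degree f. \<bar>coeff f i\<bar>)"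
    using sum_abs_coeff_ge_1[OF assms(1)] by linarith
  then have "0 \<le> ln (real_of_int (\<Sum>i\<le>degree f. \<bar>coeff f i\<bar>))" by (rule ln_ge_zero)
  then have B0: "B \<ge> 0" unfolding B_def using assms(2) by simp
  have "lcm_values f N dvd (\<Prod>n\<in>A. poly f (int n))"
    unfolding lcm_values_def A_def by (rule Lcm_least) (auto intro!: dvd_prodI)
  then have "lcm_values f N \<le> \<bar>\<Prod>n\<in>A. poly f (int n)\<bar>"
    by (intro zdvd_imp_le) (auto simp: A_def)
  also have "\<dots> = (\<Prod>n\<in>A. \<bar>poly f (int n)\<bar>)" by (rule abs_prod)
  finally have "real_of_int (lcm_values f N) \<le> real_of_int (\<Prod>n\<in>A. \<bar>poly f (int n)\<bar>)"
    by (subst of_int_le_iff)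
  then have "real_of_int (lcm_values f N) \<le> (\<Prod>n\<in>A. real (nat \<bar>poly f (int n)\<bar>))" by simp
  then have "ln (real_of_int (lcm_values f N)) \<le> ln (\<Prod>n\<in>A. real (nat \<bar>poly f (int n)\<bar>))"
    using lcm_values_pos[of f N] by (intro ln_mono) auto
  also have "\<dots> = (\<Sum>n\<in>A. ln (real (nat \<bar>poly f (int n)\<bar>)))"
    by (rule ln_prod) (auto simp: A_def)
  also have "\<dots> \<le> (\<Sum>n\<in>A. B)"
    unfolding B_def by (intro sum_mono ln_abs_poly_le) (auto simp: A_def)
  also have "\<dots> = card A * B" by simp
  also have "card A \<le> card {1..N}" by (intro card_mono) (auto simp: A_def)
  then have "card A * B \<le> N * B" using B0 by (intro mult_right_mono) auto
  finally show ?thesis by (simp add: B_def)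
qed

text \<open>The sum of \<open>ln \<bar>g(n)\<bar>\<close> is at least
  \<open>d * N * ln N - O(N)\<close>; small primes account for only half of the main term, so
  \<open>d\<close> times the logarithm of the least common multiple must supply the rest. Dividing
  by \<open>d\<close> leaves \<open>N * ln N / 2 - O(N)\<close>.\<close>

lemma ln_lcm_values_ge:
  fixes f g :: "int poly"
  assumes f: "f \<noteq> 0" and prim: "content g = 1" and deg: "degree g > 0"
    and nz: "\<And>a b. homogenize g a b = 0 \<Longrightarrow> a = 0 \<and> b = 0"
    and bez: "u * g + v * pderiv g = [:D:]" "D \<noteq> 0"
    and dvd: "g dvd smult m f" "m \<noteq> 0"
  shows "\<exists>E. \<forall>N\<ge>1. ln (real_of_int (lcm_values f N)) \<ge> N * (ln N / 2 - E)"
proof -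
  define d where "d = real (degree g)"
  define x where "x = (\<lambda>n. nat \<bar>poly g (int n)\<bar>)"
  \<comment> \<open>Zeros of \<open>f\<close> do not enter \<open>lcm_values\<close>. They are
    finitely many and \<open>g\<close> vanishes at none of them, so they cost the constant
    \<open>z\<close>.\<close>
  define Z where "Z = {n::nat. poly f (int n) = 0}"
  define z where "z = (\<Sum>n\<in>Z. ln (x n))"
  have d0: "d > 0" using deg by (simp add: d_def)
  have gnz: "poly g (int n) \<noteq> 0" for n
    using nz[of "int n" 1] homogenize_mult_left[of g "int n" 1] by auto
  have lnx: "ln (x n) \<ge> 0" for n using gnz[of n] by (simp add: x_def)
  have z0: "z \<ge> 0" unfolding z_def by (intro sum_nonneg lnx)
  have finZ: "finite Z"
  proof -
    have "finite (int -` {y. poly f y = 0})"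
      using poly_roots_finite[OF f] by (rule finite_vimageI) simp
    then show ?thesis by (simp add: Z_def vimage_def)
  qed
  obtain C1 where C1: "\<And>n. n \<ge> 1 \<Longrightarrow> ln (x n) \<ge> d * ln n - C1"
    using ln_abs_poly_ge[OF deg gnz] unfolding x_def d_def by blast
  obtain C2 where C2: "\<And>N. N \<ge> 1 \<Longrightarrow>
      (\<Sum>p\<in>primes_upto N. \<Sum>n\<in>{1..N}. real (multiplicity p (x n)) * ln p) \<le> d / 2 * (N * ln N) + C2 * N"
    using small_primes_contribution[OF prim nz bez] unfolding x_def d_def by blast
  define l where "l = ln (real_of_int \<bar>m\<bar>)"
  have l0: "l \<ge> 0" unfolding l_def using dvd(2) by (intro ln_ge_zero) linarith
  define E where "E = (d + C1 + C2 + z) / d + l"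
  have "ln (real_of_int (lcm_values f N)) \<ge> N * (ln N / 2 - E)" if N: "N \<ge> 1" for N :: nat
  proof -
    define A where "A = {1..N} - Z"
    \<comment> \<open>The factor \<open>\<bar>m\<bar>\<close> is included because \<open>g\<close>
      divides \<open>m * f\<close> rather than \<open>f\<close>.\<close>
    define L where "L = nat (\<bar>m\<bar> * lcm_values f N)"
    have L0: "L > 0" unfolding L_def using dvd(2) lcm_values_pos[of f N] by simp
    have "x n dvd L" if n: "n \<in> A" for n
    proof -
      obtain k where "smult m f = g * k" using dvd(1) by (elim dvdE)
      then have "m * poly f (int n) = poly g (int n) * poly k (int n)"
        by (metis poly_mult poly_smult)
      then have "poly g (int n) dvd m * poly f (int n)" by simp
      moreover have "poly f (int n) dvd lcm_values f N"
        unfolding lcm_values_def using n by (intro dvd_Lcm) (auto simp: A_def Z_def)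
      ultimately have "poly g (int n) dvd \<bar>m\<bar> * lcm_values f N"
        by (meson dvd_trans mult_dvd_mono dvd_refl abs_dvd_iff dvd_abs_iff)
      then show ?thesis unfolding x_def L_def using lcm_values_pos[of f N]
        by (simp add: nat_dvd_iff dvd_nat_abs_iff abs_mult flip: int_dvd_int_iff)
    qed
    then have upper: "(\<Sum>n\<in>A. ln (x n)) \<le> d / 2 * (N * ln N) + C2 * N + d * ln L"
      using sum_ln_values_le[OF prim, of A N L] C2[OF N] gnz L0
      unfolding x_def d_def by (fastforce simp: A_def)
    have "d * (N * ln N - N) - N * C1 \<le> d * (\<Sum>n\<in>{1..N}. ln (real n)) - N * C1"
      using sum_ln_ge[OF N] d0 by simp
    also have "\<dots> = (\<Sum>n\<in>{1..N}. d * ln n - C1)"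
      by (simp add: sum_subtractf sum_distrib_left)
    also have "\<dots> \<le> (\<Sum>n\<in>{1..N}. ln (x n))" using C1 by (intro sum_mono) auto
    also have "\<dots> \<le> (\<Sum>n\<in>A \<union> Z. ln (x n))"
      using finZ lnx by (intro sum_mono2) (auto simp: A_def)
    also have "\<dots> = (\<Sum>n\<in>A. ln (x n)) + z"
      unfolding z_def using finZ by (intro sum.union_disjoint) (auto simp: A_def)
    also have "\<dots> \<le> d / 2 * (N * ln N) + C2 * N + d * ln L + z" using upper by simp
    also have "z \<le> z * N" using z0 N by (simp add: mult_le_cancel_left1)
    finally have "d * (N * ln N) / 2 - (d + C1 + C2 + z) * N \<le> d * ln L"
      by (simp add: algebra_simps)
    then have "(d * (N * ln N) / 2 - (d + C1 + C2 + z) * N) / d \<le> ln L"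
      using d0 by (simp add: field_simps)
    moreover have "(d * (N * ln N) / 2 - (d + C1 + C2 + z) * N) / d = N * (ln N / 2 - (d + C1 + C2 + z) / d)"
      using d0 by (simp add: field_simps)
    moreover have "ln L = l + ln (real_of_int (lcm_values f N))"
      unfolding L_def l_def using dvd(2) lcm_values_pos[of f N] by (simp add: ln_mult)
    moreover have "l \<le> l * N" using l0 N by (simp add: mult_le_cancel_left1)
    moreover have "N * (ln N / 2 - E) = N * (ln N / 2 - (d + C1 + C2 + z) / d) - l * N"
      unfolding E_def by (simp only: algebra_simps)
    ultimately show ?thesis by linarith
  qed
  then show ?thesis by blast
qed

theorem corollary1p3:
  fixes f :: "int poly"
  assumes "f \<noteq> 0"
    and "\<exists>g :: rat poly. irreducible g \<and> degree g \<ge> 2 \<and> g dvd map_poly of_int f"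
  shows "(\<exists>C>0. \<forall>\<^sub>F N in sequentially.
            real N * ln (real N) \<le> C * ln (real_of_int (lcm_values f N))) \<and>
         (\<exists>C>0. \<forall>\<^sub>F N in sequentially.
            ln (real_of_int (lcm_values f N)) \<le> C * (real N * ln (real N)))"
proof
  have large: "\<forall>\<^sub>F N in sequentially. ln (real N) \<ge> K" for K
    by (rule filterlim_at_top [THEN iffD1, rule_format,
          OF filterlim_compose[OF ln_at_top filterlim_real_sequentially]])
  obtain h :: "rat poly" where h: "irreducible h" "degree h \<ge> 2" "h dvd rat_poly f"
    using assms(2) by blast
  obtain g m where g: "content g = 1" "degree g = degree h" "irreducible (rat_poly g)"
    "g dvd smult m f" "m \<noteq> 0"
    using primitive_int_factor[OF h(3,1)] by blast
  have deg: "degree g > 0" using g(2) h(2) by simp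
  obtain u v D where bez: "u * g + v * pderiv g = [:D:]" "D \<noteq> 0"
    using bezout_pderiv[OF g(3) deg] by blast
  have "poly (rat_poly g) x \<noteq> 0" for x
    using irreducible_no_root[OF g(3)] g(2) h(2) by (simp add: degree_rat_poly)
  then have nz: "a = 0 \<and> b = 0" if "homogenize g a b = 0" for a b
    using homogenize_eq_0_iff[OF deg] that by simp
  obtain E where E: "\<And>N. N \<ge> 1 \<Longrightarrow> ln (real_of_int (lcm_values f N)) \<ge> N * (ln N / 2 - E)"
    using ln_lcm_values_ge[OF assms(1) g(1) deg nz bez g(4,5)] by blast
  \<comment> \<open>Once \<open>ln N \<ge> 4 * E\<close>, the factor \<open>ln N / 2 - E\<close> is
    at least \<open>ln N / 4\<close>.\<close>
  have "\<forall>\<^sub>F N in sequentially. real N * ln (real N) \<le> 4 * ln (real_of_int (lcm_values f N))"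
    using large[of "4 * E"] eventually_ge_at_top[of 1]
  proof eventually_elim
    case (elim N)
    have "real N * ln N = 4 * (N * (ln N / 2 - ln N / 4))" by (simp add: field_simps)
    also have "\<dots> \<le> 4 * (N * (ln N / 2 - E))"
      using elim(1) by (intro mult_left_mono) auto
    also have "\<dots> \<le> 4 * ln (real_of_int (lcm_values f N))" using E[OF elim(2)] by simp
    finally show ?case .
  qed
  then show "\<exists>C>0. \<forall>\<^sub>F N in sequentially. real N * ln (real N) \<le> C * ln (real_of_int (lcm_values f N))"
    by (intro exI[of _ 4]) auto
  define c where "c = ln (real_of_int (\<Sum>i\<le>degree f. \<bar>coeff f i\<bar>))"
  \<comment> \<open>Once \<open>ln N \<ge> c\<close>, one further \<open>ln N\<close> absorbs the
    coefficient constant, which explains \<open>degree f + 1\<close>.\<close>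
  have "\<forall>\<^sub>F N in sequentially. ln (real_of_int (lcm_values f N)) \<le> (degree f + 1) * (real N * ln (real N))"
    using large[of c] eventually_ge_at_top[of 1]
  proof eventually_elim
    case (elim N)
    have "ln (real_of_int (lcm_values f N)) \<le> N * (c + degree f * ln N)"
      unfolding c_def by (rule ln_lcm_values_le[OF assms(1) elim(2)])
    also have "\<dots> \<le> N * (ln N + degree f * ln N)" using elim(1) by (intro mult_left_mono) auto
    also have "\<dots> = (degree f + 1) * (real N * ln (real N))" by (simp add: algebra_simps)
    finally show ?case .
  qed
  then show "\<exists>C>0. \<forall>\<^sub>F N in sequentially. ln (real_of_int (lcm_values f N)) \<le> C * (real N * ln (real N))"
    by (intro exI[of _ "real (degree f + 1)"]) auto
qed

end
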